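(* Let $F=c_1(x_1^2x_2+x_3^2x_4+x_5^2x_6)+c_2(x_2^2x_3+x_4^2x_5+x_6^2x_1)+c_3x_1x_3x_5+c_4x_2x_4x_6$ with $c_i\in\mathbb{C}$. Then $F$ is $N_{\mathrm{SL}(6,\mathbb{C})}(G_2)$-stable if and only if one of the following holds: (1) $c_1,c_2\neq0$; (2) $c_1,c_4\neq0$; (3) $c_2,c_3\neq0$; (4) $c_3,c_4\neq0$. Moreover, if $F$ is $N_{\mathrm{SL}(6,\mathbb{C})}(G_2)$-semistable then it is $N_{\mathrm{SL}(6,\mathbb{C})}(G_2)$-stable. In particular, the unstable locus consists of the two projective lines $c_1=c_3=0$ and $c_2=c_4=0$.
   Context: Let $F_{21}\subset\mathrm{SL}(6,\mathbb{C})$ be the nonabelian group of order $21$ generated by $g_7=\mathrm{diag}(\zeta,\zeta^5,\zeta^4,\zeta^6,\zeta^2,\zeta^3)$, $\zeta=e^{2\pi i/7}$, and the permutation matrix $g_3:e_i\mapsto e_{i+2}$ (indices mod $6$). Let $\mu_6$ be the scalar matrices in $\mathrm{SL}(6,\mathbb{C})$ and $G_2=\mu_6F_{21}$. The space $\mathcal{V}_{F_{21}}$ of $F_{21}$-invariant cubic forms in $x_1,\dots,x_6$ consists of the forms $F$ in the claim, so $\mathbb{P}\mathcal{V}_{F_{21}}\cong\mathbb{P}^3$ with coordinates $[c_1:c_2:c_3:c_4]$. The reductive group $N_{\mathrm{SL}(6,\mathbb{C})}(G_2)$ (with identity component $\{\mathrm{diag}(a,a^{-1},a,a^{-1},a,a^{-1})\}\cong\mathbb{C}^\times$)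 acts linearly on $\mathcal{V}_{F_{21}}$ by linear change of variables; (semi)stability is in the sense of GIT for this action on $\mathbb{P}\mathcal{V}_{F_{21}}$, and the unstable locus is the complement of the semistable locus in $\mathbb{P}\mathcal{V}_{F_{21}}$. *)

theory Defs
  imports
    "HOL-Analysis.Analysis"
    "HOL-Algebra.Generated_Groups"
    "HOL-Algebra.Group_Action"
    "HOL-Library.Function_Algebras"
begin

text \<open>
  Throughout, \<open>V\<close> is a complex vector space given as a subspace of a type \<open>'v\<close> with scalar
  multiplication \<open>s\<close>. Polynomials over the infinite field of complex numbers are identified with
  polynomial functions: \<^term>\<open>form s V d f\<close> says that \<open>f\<close> restricts to an element of the \<open>d\<close>-th
  symmetric power of the dual of \<open>V\<close>. The values of \<open>f\<close> outside \<open>V\<close> are irrelevant.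
\<close>

inductive form :: "(complex \<Rightarrow> 'v \<Rightarrow> 'v) \<Rightarrow> 'v::ab_group_add set \<Rightarrow> nat \<Rightarrow> ('v \<Rightarrow> complex) \<Rightarrow> bool"
  for s V where
  const: "form s V 0 (\<lambda>_. a)"
| linear: "\<lbrakk>\<And>u v. u \<in> V \<Longrightarrow> v \<in> V \<Longrightarrow> l (u + v) = l u + l v;
            \<And>a v. v \<in> V \<Longrightarrow> l (s a v) = a * l v\<rbrakk> \<Longrightarrow> form s V 1 l"
| add: "\<lbrakk>form s V d f; form s V d g\<rbrakk> \<Longrightarrow> form s V d (\<lambda>v. f v + g v)"
| mult: "\<lbrakk>form s V d f; form s V e g\<rbrakk> \<Longrightarrow> form s V (d + e) (\<lambda>v. f v * g v)"

text \<open>The point \<open>[v]\<close> of \<open>P(V)\<close> is the punctured line spanned by \<open>v\<close>.\<close>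

definition pt :: "(complex \<Rightarrow> 'v \<Rightarrow> 'v) \<Rightarrow> 'v \<Rightarrow> 'v set" where
  "pt s v = {s t v | t. t \<noteq> 0}"

definition proj :: "(complex \<Rightarrow> 'v \<Rightarrow> 'v) \<Rightarrow> 'v::ab_group_add set \<Rightarrow> 'v set set" where
  "proj s V = pt s ` (V - {0})"

definition zariski_closed ::
    "(complex \<Rightarrow> 'v \<Rightarrow> 'v) \<Rightarrow> 'v::ab_group_add set \<Rightarrow> 'v set set \<Rightarrow> bool" where
  "zariski_closed s V Z \<longleftrightarrow>
    (\<exists>H. (\<forall>h\<in>H. \<exists>d. form s V d h) \<and> Z = {p \<in> proj s V. \<forall>h\<in>H. \<forall>v\<in>p. h v = 0})"

definition nonvanishing ::
    "(complex \<Rightarrow> 'v \<Rightarrow> 'v) \<Rightarrow> 'v::ab_group_add set \<Rightarrow> ('v \<Rightarrow> complex) \<Rightarrow> 'v set set" where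
  "nonvanishing s V f = {p \<in> proj s V. \<forall>v\<in>p. f v \<noteq> 0}"

text \<open>
  \<open>\<phi>\<close> is a linear action of the group \<open>G\<close> on \<open>V\<close>; the induced action of \<open>g\<close> on \<open>P(V)\<close>
  is \<open>p \<mapsto> \<phi> g ` p\<close>. The linearization is the standard one on \<open>O(1)\<close>, so that the
  invariant sections of \<open>O(d)\<close> are the invariant forms of degree \<open>d\<close>; their nonvanishing loci are
  automatically affine. A point is stable if it has a finite stabilizer and lies in the nonvanishing
  locus of an invariant form of positive degree in which all orbits are closed. This is Mumford's
  \<open>properly stable\<close>; finiteness of the stabilizer says that the orbit has dimension \<open>dim G\<close>.
\<close>

definition invariant_form ::
    "(complex \<Rightarrow> 'v \<Rightarrow> 'v) \<Rightarrow> 'v::ab_group_add set \<Rightarrow> ('g, 'x) monoid_scheme \<Rightarrow> ('g \<Rightarrow> 'v \<Rightarrow> 'v)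
      \<Rightarrow> nat \<Rightarrow> ('v \<Rightarrow> complex) \<Rightarrow> bool" where
  "invariant_form s V G \<phi> d f \<longleftrightarrow>
    form s V d f \<and> (\<forall>g\<in>carrier G. \<forall>v\<in>V. f (\<phi> g v) = f v)"

definition semistable ::
    "(complex \<Rightarrow> 'v \<Rightarrow> 'v) \<Rightarrow> 'v::ab_group_add set \<Rightarrow> ('g, 'x) monoid_scheme \<Rightarrow> ('g \<Rightarrow> 'v \<Rightarrow> 'v)
      \<Rightarrow> 'v set \<Rightarrow> bool" where
  "semistable s V G \<phi> p \<longleftrightarrow>
    (\<exists>d f. d > 0 \<and> invariant_form s V G \<phi> d f \<and> p \<in> nonvanishing s V f)"

definition stable ::
    "(complex \<Rightarrow> 'v \<Rightarrow> 'v) \<Rightarrow> 'v::ab_group_add set \<Rightarrow> ('g, 'x) monoid_scheme \<Rightarrow> ('g \<Rightarrow> 'v \<Rightarrow> 'v)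
      \<Rightarrow> 'v set \<Rightarrow> bool" where
  "stable s V G \<phi> p \<longleftrightarrow>
    finite (stabilizer G (\<lambda>g. (`) (\<phi> g)) p) \<and>
    (\<exists>d f. d > 0 \<and> invariant_form s V G \<phi> d f \<and> p \<in> nonvanishing s V f \<and>
      (\<forall>q \<in> nonvanishing s V f. \<exists>Z. zariski_closed s V Z \<and>
        orbit G (\<lambda>g. (`) (\<phi> g)) q = Z \<inter> nonvanishing s V f))"

definition unstable_locus ::
    "(complex \<Rightarrow> 'v \<Rightarrow> 'v) \<Rightarrow> 'v::ab_group_add set \<Rightarrow> ('g, 'x) monoid_scheme \<Rightarrow> ('g \<Rightarrow> 'v \<Rightarrow> 'v)
      \<Rightarrow> 'v set set" where
  "unstable_locus s V G \<phi> = {p \<in> proj s V. \<not> semistable s V G \<phi> p}"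

text \<open>
  The index type \<^typ>\<open>6\<close> is the ring of integers modulo 6, so its elements are \<open>1, \<dots>, 6\<close> with
  \<open>6 = 0\<close>, and index arithmetic is modulo 6.
\<close>

definition SL6 :: "(complex^6^6) monoid" where
  "SL6 = \<lparr>carrier = {A. det A = 1}, mult = (**), one = mat 1\<rparr>"

definition \<zeta> :: complex where
  "\<zeta> = exp (2 * pi * \<i> / 7)"

definition g7 :: "complex^6^6" where
  "g7 = (\<chi> i j. if i = j then vector [\<zeta>, \<zeta>^5, \<zeta>^4, \<zeta>^6, \<zeta>^2, \<zeta>^3] $ i else 0)"

text \<open>The matrix with \<open>g3 e\<^sub>j = e\<^sub>j\<^sub>+\<^sub>2\<close>.\<close>

definition g3 :: "complex^6^6" where
  "g3 = (\<chi> i j. if i = j + 2 then 1 else 0)"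

definition F21 :: "(complex^6^6) set" where
  "F21 = generate SL6 {g7, g3}"

definition mu6 :: "(complex^6^6) set" where
  "mu6 = {A \<in> carrier SL6. \<exists>z. A = mat z}"

definition G2 :: "(complex^6^6) set" where
  "G2 = mu6 <#>\<^bsub>SL6\<^esub> F21"

definition N :: "(complex^6^6) monoid" where
  "N = SL6\<lparr>carrier := normalizer SL6 G2\<rparr>"

definition act :: "complex^6^6 \<Rightarrow> (complex^6 \<Rightarrow> complex) \<Rightarrow> (complex^6 \<Rightarrow> complex)" where
  "act g F = (\<lambda>x. F (matrix_inv g *v x))"

definition scale_fun :: "complex \<Rightarrow> (complex^6 \<Rightarrow> complex) \<Rightarrow> (complex^6 \<Rightarrow> complex)" where
  "scale_fun t F = (\<lambda>x. t * F x)"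

definition V_F21 :: "(complex^6 \<Rightarrow> complex) set" where
  "V_F21 = {F. form (*s) UNIV 3 F \<and> (\<forall>g\<in>F21. act g F = F)}"

definition cubic :: "complex \<Rightarrow> complex \<Rightarrow> complex \<Rightarrow> complex \<Rightarrow> complex^6 \<Rightarrow> complex" where
  "cubic c1 c2 c3 c4 = (\<lambda>x.
      c1 * ((x$1)\<^sup>2 * x$2 + (x$3)\<^sup>2 * x$4 + (x$5)\<^sup>2 * x$6)
    + c2 * ((x$2)\<^sup>2 * x$3 + (x$4)\<^sup>2 * x$5 + (x$6)\<^sup>2 * x$1)
    + c3 * (x$1 * x$3 * x$5) + c4 * (x$2 * x$4 * x$6))"

abbreviation cubic_pt :: "complex \<Rightarrow> complex \<Rightarrow> complex \<Rightarrow> complex \<Rightarrow> (complex^6 \<Rightarrow> complex) set" where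
  "cubic_pt c1 c2 c3 c4 \<equiv> pt scale_fun (cubic c1 c2 c3 c4)"

abbreviation N_semistable :: "(complex^6 \<Rightarrow> complex) set \<Rightarrow> bool" where
  "N_semistable \<equiv> semistable scale_fun V_F21 N act"

abbreviation N_stable :: "(complex^6 \<Rightarrow> complex) set \<Rightarrow> bool" where
  "N_stable \<equiv> stable scale_fun V_F21 N act"

end

theory Submission
  imports Defs "HOL-Number_Theory.Cong"
begin

text \<open>
  The eigenvalues of \<open>g7\<close> are the six primitive seventh roots of unity, and conjugation by an element
  \<open>g\<close> of the normalizer sends \<open>g7\<close> to a power of itself (compare traces). Hence \<open>g\<close> permutes the
  coordinate axes, and the permutation is a shift of the indices modulo 6. On the coefficients it acts by
  \<open>(\<alpha> c\<^sub>1, \<beta> c\<^sub>2, \<gamma> c\<^sub>3, \<delta> c\<^sub>4)\<close>, possibly after exchanging \<open>c\<^sub>1, c\<^sub>2\<close> and \<open>c\<^sub>3, c\<^sub>4\<close>, where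
  \<open>\<alpha>\<^sup>3 = \<gamma>\<^sup>2\<delta>\<close>, \<open>\<beta>\<^sup>3 = \<gamma>\<delta>\<^sup>2\<close> and \<open>\<gamma>\<delta> = \<plusminus>1\<close>; the torus contributes the weights \<open>-1, 1, -3, 3\<close>.
  With \<open>A = c\<^sub>1c\<^sub>2\<close>, \<open>B = c\<^sub>3c\<^sub>4\<close>, \<open>C = c\<^sub>1\<^sup>3c\<^sub>4\<close>, \<open>D = c\<^sub>2\<^sup>3c\<^sub>3\<close>, the invariants \<open>B\<^sup>2\<close>, \<open>C + D\<close>,
  \<open>CD = A\<^sup>3B\<close> and \<open>A\<^sup>6\<close> vanish simultaneously exactly on the two lines, which the torus contracts to
  the origin, and they separate the orbits outside the two lines. So the orbits of semistable points are
  closed in the semistable locus.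
\<close>

section \<open>The group \<open>G2\<close>\<close>

text \<open>Signs and roots of unity decide which invariants exist. Determinant 1 fixes the product
  of the six monomial entries only up to the sign of the index shift, and odd shifts have sign -1.
  So \<open>B\<close> and \<open>A^3\<close> are fixed only up to a common sign, and
  \<open>A\<close> itself only up to a further cube root of unity, whereas \<open>C\<close> and
  \<open>D\<close> are fixed exactly but exchanged by odd shifts. Hence squares for the first two
  and symmetric functions for the last two. Projective points add a scalar. The invariants have
  degrees 4, 4, 8, 12, all divisible by 4, so their values form a point of the weighted projective
  space P(1,1,2,3), and one rescaling of a representative turns proportional values into equal ones.
  Closedness of an orbit then needs no quotient: the equations \<open>i F * j u = i u * j F\<close>,
  over pairs of invariants of equal degree, cut it out. Finiteness of stabilizers is not obtained by
  a dimension count. The coefficient factors of a stabilizing element satisfy explicit root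
  equations, these bound a fixed power of every matrix entry, and so only finitely many matrices
  occur.\<close>

lemma exhaust_6: fixes x :: 6 shows "x = 1 \<or> x = 2 \<or> x = 3 \<or> x = 4 \<or> x = 5 \<or> x = 6"
proof (induct x)
  case (of_int z)
  then have "0 \<le> z" and "z < 6" by simp_all
  then have "z = 0 \<or> z = 1 \<or> z = 2 \<or> z = 3 \<or> z = 4 \<or> z = 5" by arith
  then show ?case by auto
qed

lemma forall_6: "(\<forall>i::6. P i) \<longleftrightarrow> P 1 \<and> P 2 \<and> P 3 \<and> P 4 \<and> P 5 \<and> P 6"
  by (metis exhaust_6)

lemma UNIV_6: "UNIV = {1::6, 2, 3, 4, 5, 6}"
  using exhaust_6 by auto

lemma sum_6: "sum f (UNIV::6 set) = f 1 + f 2 + f 3 + f 4 + f 5 + f 6"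
  unfolding UNIV_6 by (simp add: ac_simps)

lemma prod_6: "prod f (UNIV::6 set) = f 1 * f 2 * f 3 * f 4 * f 5 * f 6"
  unfolding UNIV_6 by (simp add: ac_simps)

lemma wrap_6:
  "(7::6) = 1" "(8::6) = 2" "(9::6) = 3" "(10::6) = 4" "(11::6) = 5" "(0::6) = 6"
  "(12::6) = 6" "(- 1::6) = 5" "(- 2::6) = 4" "(- 3::6) = 3" "(- 4::6) = 2" "(- 5::6) = 1"
  "(13::6) = 1" "(14::6) = 2" "(15::6) = 3" "(16::6) = 4" "(17::6) = 5" "(18::6) = 6"
  "(19::6) = 1" "(20::6) = 2" "(21::6) = 3" "(22::6) = 4" "(23::6) = 5" "(24::6) = 6"
  "(25::6) = 1" "(26::6) = 2" "(27::6) = 3" "(28::6) = 4" "(29::6) = 5" "(30::6) = 6"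
  "(31::6) = 1" "(32::6) = 2" "(33::6) = 3" "(34::6) = 4" "(35::6) = 5" "(36::6) = 6"
  by simp_all

section \<open>Seventh roots of unity, the weights of \<open>g7\<close> and a normal form for
  \<open>F21\<close>\<close>

lemma \<zeta>_power: "\<zeta> ^ n = exp (2 * of_real pi * \<i> * of_nat n / of_nat 7)"
  unfolding \<zeta>_def exp_of_nat_mult[symmetric] by (simp add: algebra_simps)

lemma \<zeta>_power_eq_iff: "\<zeta> ^ m = \<zeta> ^ n \<longleftrightarrow> m mod 7 = n mod 7"
  unfolding \<zeta>_power by (rule complex_root_unity_eq) simp

lemma \<zeta>_power_7 [simp]: "\<zeta> ^ 7 = 1"
  using \<zeta>_power_eq_iff[of 7 0] by simp

text \<open>Orthogonality of characters of Z/7: for s prime to 7 the terms form a geometric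
  progression whose ratio is a nontrivial seventh root of unity.\<close>

lemma \<zeta>_sum: "(\<Sum>n<7. \<zeta> ^ (n * s)) = (if 7 dvd s then 7 else 0)"
proof (cases "7 dvd s")
  case True
  then have "\<zeta> ^ (n * s) = 1" for n
    using \<zeta>_power_eq_iff[of "n * s" 0] by simp
  then show ?thesis using True by simp
next
  case False
  then have ne: "\<zeta> ^ s \<noteq> 1"
    using \<zeta>_power_eq_iff[of s 0] by (simp add: mod_eq_0_iff_dvd)
  have "(\<Sum>n<7. \<zeta> ^ (n * s)) = (\<Sum>n<7. (\<zeta> ^ s) ^ n)"
    by (simp add: power_mult[symmetric] mult.commute)
  also have "\<dots> = ((\<zeta> ^ s) ^ 7 - 1) / (\<zeta> ^ s - 1)"
    by (rule geometric_sum[OF ne])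
  also have "(\<zeta> ^ s) ^ 7 = 1"
    by (simp add: power_mult[symmetric] mult.commute[of s]) (simp add: power_mult)
  finally show ?thesis using False by simp
qed

text \<open>
  The exponents of \<open>g7\<close>. Since \<open>wt i\<close> is \<open>5\<^sup>i\<^sup>-\<^sup>1\<close> modulo 7 and 5 is a primitive root, multiplying
  the weights by a unit amounts to shifting the indices.
\<close>

definition wt :: "6 \<Rightarrow> nat" where
  "wt i = (if i = 1 then 1 else if i = 2 then 5 else if i = 3 then 4
           else if i = 4 then 6 else if i = 5 then 2 else 3)"

lemma wt_simps [simp]: "wt 1 = 1" "wt 2 = 5" "wt 3 = 4" "wt 4 = 6" "wt 5 = 2" "wt 6 = 3"
  by (simp_all add: wt_def)

lemma g7_entry: "g7 $ i $ j = (if i = j then \<zeta> ^ wt i else 0)"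
proof -
  have "(vector [\<zeta>, \<zeta>^5, \<zeta>^4, \<zeta>^6, \<zeta>^2, \<zeta>^3] :: complex^6) $ i = \<zeta> ^ wt i" for i
    using exhaust_6[of i] by (auto simp: vector_def)
  then show ?thesis by (simp add: g7_def)
qed

lemma g7_mult: "(g7 *v x) $ i = \<zeta> ^ wt i * x $ i"
  by (simp add: matrix_vector_mult_def g7_entry if_distrib[where f="\<lambda>u. u * _"] sum.delta cong: if_cong)

lemma g3_mult: "(g3 *v x) $ i = x $ (i - 2)"
proof -
  have "(i = j + 2) = (j = i - 2)" for j :: 6 by (metis add_diff_cancel diff_add_cancel)
  then show ?thesis
    by (simp add: matrix_vector_mult_def g3_def if_distrib[where f="\<lambda>u. u * _"] sum.delta cong: if_cong)
qed

text \<open>The n-th power of \<open>g7\<close> times the permutation that shifts indices by p.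
  Entries are given outright so that products and traces can be computed entrywise.\<close>

definition shift_diag :: "nat \<Rightarrow> 6 \<Rightarrow> complex^6^6" where
  "shift_diag n p = (\<chi> r k. if k = r - p then \<zeta> ^ (n * wt r) else 0)"

definition F21_list :: "(complex^6^6) set" where
  "F21_list = {shift_diag n p | n p. p \<in> {0, 2, 4}}"

lemma shift_diag_mult:
  "(shift_diag n p ** shift_diag n' p') $ r $ k =
     (if k = r - p - p' then \<zeta> ^ (n * wt r + n' * wt (r - p)) else 0)"
  by (simp add: matrix_matrix_mult_def shift_diag_def if_distrib[where f="\<lambda>u. u * _"] sum.delta
     power_add cong: if_cong)

lemma wt_minus_2: "[wt (r - 2) = 2 * wt r] (mod 7)"
  using exhaust_6[of r] by (auto simp: cong_def wrap_6)

lemma wt_minus_4: "[wt (r - 4) = 4 * wt r] (mod 7)"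
  using exhaust_6[of r] by (auto simp: cong_def wrap_6)

text \<open>Even shifts multiply the weights by the squares 1, 2, 4 modulo 7 (5^-2 = 2). This moves
  a permutation past a power of \<open>g7\<close> and makes the normal forms closed under
  products.\<close>

lemma wt_minus:
  assumes "p \<in> {0, 2, 4::6}" shows "\<exists>t. \<forall>r. [wt (r - p) = t * wt r] (mod 7)"
proof -
  have "[wt (r - 0) = 1 * wt r] (mod 7)" for r by simp
  then show ?thesis using assms wt_minus_2 wt_minus_4 by blast
qed

lemma F21_list_mult:
  assumes "A \<in> F21_list" "B \<in> F21_list" shows "A ** B \<in> F21_list"
proof -
  obtain n p n' p' where A: "A = shift_diag n p" "p \<in> {0, 2, 4}"
    and B: "B = shift_diag n' p'" "p' \<in> {0, 2, 4}"
    using assms unfolding F21_list_def by blast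
  obtain t where t: "\<And>r. [wt (r - p) = t * wt r] (mod 7)"
    using wt_minus[OF A(2)] by blast
  have e: "\<zeta> ^ (n * wt r + n' * wt (r - p)) = \<zeta> ^ ((n + n' * t) * wt r)" for r
    unfolding \<zeta>_power_eq_iff cong_def[symmetric] distrib_right mult.assoc
    by (intro cong_add cong_mult cong_refl t)
  have "A ** B = shift_diag (n + n' * t) (p + p')"
    unfolding A B by (simp add: vec_eq_iff shift_diag_mult e) (simp add: shift_diag_def diff_diff_eq)
  moreover have "p + p' \<in> {0, 2, 4}" using A(2) B(2) by auto
  ultimately show ?thesis unfolding F21_list_def by blast
qed

section \<open>Inverses, determinants and the groups \<open>SL6\<close>, \<open>F21\<close>,
  \<open>G2\<close>\<close>

lemma invertible_matrix_inv:
  fixes A :: "complex^6^6" assumes "invertible A"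
  shows "A ** matrix_inv A = mat 1 \<and> matrix_inv A ** A = mat 1"
  using assms unfolding invertible_def matrix_inv_def by (rule someI_ex)

lemma matrix_inv_unique:
  fixes A B :: "complex^6^6" assumes "B ** A = mat 1" shows "matrix_inv A = B"
proof -
  have "A ** B = mat 1" using assms by (simp add: matrix_left_right_inverse)
  then have "invertible A" using assms by (auto simp: invertible_def)
  then have "matrix_inv A = (B ** A) ** matrix_inv A" by (simp add: assms)
  also have "\<dots> = B"
    unfolding matrix_mul_assoc[symmetric] using invertible_matrix_inv[OF \<open>invertible A\<close>] by simp
  finally show ?thesis .
qed

lemma carrier_SL6: "A \<in> carrier SL6 \<longleftrightarrow> det A = 1"
  by (simp add: SL6_def)

lemma det_1_inv:
  fixes A :: "complex^6^6" assumes "det A = 1"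
  shows "A ** matrix_inv A = mat 1" "matrix_inv A ** A = mat 1" "det (matrix_inv A) = 1"
proof -
  have "invertible A" using assms by (simp add: invertible_det_nz)
  then have *: "A ** matrix_inv A = mat 1 \<and> matrix_inv A ** A = mat 1"
    by (rule invertible_matrix_inv)
  then show "A ** matrix_inv A = mat 1" "matrix_inv A ** A = mat 1" by auto
  from * show "det (matrix_inv A) = 1"
    by (metis assms det_I det_mul mult_1)
qed

lemma group_SL6: "group SL6"
proof (rule groupI)
  fix x assume "x \<in> carrier SL6"
  then show "\<exists>y\<in>carrier SL6. y \<otimes>\<^bsub>SL6\<^esub> x = \<one>\<^bsub>SL6\<^esub>"
    using det_1_inv[of x] by (auto simp: SL6_def)
qed (auto simp: SL6_def det_mul matrix_mul_assoc)

lemma inv_SL6: "det A = 1 \<Longrightarrow> inv\<^bsub>SL6\<^esub> A = matrix_inv A"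
  using det_1_inv[of A] by (intro group.inv_equality[OF group_SL6]) (auto simp: SL6_def)

lemma shift_diag_id: "shift_diag 0 0 = mat 1"
  by (simp add: shift_diag_def mat_def vec_eq_iff)

lemma g7_shift_diag: "g7 = shift_diag 1 0"
  by (simp add: shift_diag_def vec_eq_iff g7_entry)

lemma g3_shift_diag: "g3 = shift_diag 0 2"
proof -
  have "(i = j + 2) = (j = i - 2)" for i j :: 6 by (metis add_diff_cancel diff_add_cancel)
  then show ?thesis by (simp add: shift_diag_def vec_eq_iff g3_def)
qed

lemma matrix_inv_g7: "matrix_inv g7 = shift_diag 6 0"
  by (intro matrix_inv_unique)
     (auto simp: vec_eq_iff g7_shift_diag shift_diag_mult mat_def power_mult)

lemma matrix_inv_g3: "matrix_inv g3 = shift_diag 0 4"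
  by (intro matrix_inv_unique) (auto simp: vec_eq_iff g3_shift_diag shift_diag_mult mat_def diff_diff_eq)

lemma det_g7: "det g7 = 1"
proof -
  have "det g7 = (\<Prod>i\<in>UNIV. \<zeta> ^ wt i)"
    by (subst det_diagonal) (auto simp: g7_entry)
  also have "\<dots> = \<zeta> ^ 21"
    by (simp only: prod_6 wt_simps flip: power_add) simp
  also have "\<dots> = 1" using \<zeta>_power_eq_iff[of 21 0] by simp
  finally show ?thesis .
qed

text \<open>A permutation matrix of order 3 has its square as inverse, hence as transpose. So the
  determinant equals its own square and is nonzero, and no permutation sign has to be
  computed.\<close>

lemma det_g3: "det g3 = 1"
proof -
  have "(r = k - 2) = (k = r - 4)" for r k :: 6
    using diff_eq_eq[of k 2 r] diff_eq_eq[of r 4 k] by (auto simp: wrap_6 algebra_simps)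
  then have "transpose g3 = g3 ** g3"
    by (simp add: vec_eq_iff g3_shift_diag shift_diag_mult diff_diff_eq)
       (simp add: transpose_def shift_diag_def)
  then have "det g3 = det g3 * det g3"
    by (metis det_mul det_transpose)
  moreover have "g3 ** shift_diag 0 4 = mat 1"
    by (auto simp: vec_eq_iff g3_shift_diag shift_diag_mult mat_def diff_diff_eq)
  then have "det g3 \<noteq> 0" by (metis det_I det_mul mult_zero_left zero_neq_one)
  ultimately show ?thesis by simp
qed

lemma F21_subset_list: "A \<in> F21 \<Longrightarrow> A \<in> F21_list"
  unfolding F21_def
proof (induction rule: generate.induct)
  case one
  have "\<one>\<^bsub>SL6\<^esub> = shift_diag 0 0" by (simp add: SL6_def shift_diag_id)
  then show ?case unfolding F21_list_def by blast
next
  case (incl h)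
  then show ?case unfolding F21_list_def using g7_shift_diag g3_shift_diag by auto
next
  case (inv h)
  then have "inv\<^bsub>SL6\<^esub> h \<in> {shift_diag 6 0, shift_diag 0 4}"
    using inv_SL6 det_g7 det_g3 matrix_inv_g7 matrix_inv_g3 by auto
  then show ?case unfolding F21_list_def by auto
next
  case (eng h1 h2)
  then show ?case using F21_list_mult by (simp add: SL6_def)
qed

lemma F21_subset_carrier: "F21 \<subseteq> carrier SL6"
  unfolding F21_def by (intro group.generate_incl group_SL6) (auto simp: carrier_SL6 det_g7 det_g3)

lemma g7_in_F21: "g7 \<in> F21" and g3_in_F21: "g3 \<in> F21"
  unfolding F21_def by (auto intro: generate.incl)

lemma F21_mult: "A \<in> F21 \<Longrightarrow> B \<in> F21 \<Longrightarrow> A ** B \<in> F21"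
  unfolding F21_def using generate.eng[of A SL6 "{g7, g3}" B] by (simp add: SL6_def)

lemma mat_1_in_F21: "mat 1 \<in> F21"
  unfolding F21_def using generate.one[of SL6] by (simp add: SL6_def)

lemma det_mat_6: "det (mat z :: complex^6^6) = z ^ 6"
  by (subst det_diagonal) (auto simp: mat_def)

lemma mat_mult_entry: "((mat z :: complex^6^6) ** A) $ i $ j = z * A $ i $ j"
  by (simp add: mat_def matrix_matrix_mult_def if_distrib[where f="\<lambda>u. u * _"] sum.delta cong: if_cong)

lemma mult_mat_entry: "(A ** (mat z :: complex^6^6)) $ i $ j = z * A $ i $ j"
  by (simp add: mat_def matrix_matrix_mult_def if_distrib[where f="\<lambda>u. _ * u"] sum.delta' cong: if_cong)

lemma mat_commute: "mat z ** (A :: complex^6^6) = A ** mat z"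
  by (simp only: vec_eq_iff mat_mult_entry mult_mat_entry) simp

lemma mat_mat_6: "(mat z :: complex^6^6) ** mat w = mat (z * w)"
  by (simp add: vec_eq_iff mat_mult_entry) (simp add: mat_def)

lemma mat_vec_6: "(mat z :: complex^6^6) *v x = z *s x"
  by (simp add: vec_eq_iff mat_def matrix_vector_mult_def if_distrib[where f="\<lambda>u. u * _"] sum.delta cong: if_cong)

lemma G2_iff: "A \<in> G2 \<longleftrightarrow> (\<exists>z B. z ^ 6 = 1 \<and> B \<in> F21 \<and> A = mat z ** B)"
proof -
  have "A \<in> G2 \<longleftrightarrow> (\<exists>h\<in>{A. det A = 1 \<and> (\<exists>z. A = mat z)}. \<exists>B\<in>F21. A = h ** B)"
    unfolding G2_def set_mult_def mu6_def carrier_SL6 by (simp add: SL6_def)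
  also have "\<dots> \<longleftrightarrow> (\<exists>z B. z ^ 6 = 1 \<and> B \<in> F21 \<and> A = mat z ** B)"
    using det_mat_6 by (simp add: Bex_def) metis
  finally show ?thesis .
qed

section \<open>Invariant cubic forms\<close>

lemma vector_6 [simp]:
  "(vector [a, b, c, d, e, f] :: complex^6) $ 1 = a"
  "(vector [a, b, c, d, e, f] :: complex^6) $ 2 = b"
  "(vector [a, b, c, d, e, f] :: complex^6) $ 3 = c"
  "(vector [a, b, c, d, e, f] :: complex^6) $ 4 = d"
  "(vector [a, b, c, d, e, f] :: complex^6) $ 5 = e"
  "(vector [a, b, c, d, e, f] :: complex^6) $ 6 = f"
  unfolding vector_def by simp_all

section \<open>Forms and their expansion into monomials\<close>

lemma form_homogeneous:
  assumes "form s V d f" "\<And>t v. v \<in> V \<Longrightarrow> s t v \<in> V" "v \<in> V"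
  shows "f (s t v) = t ^ d * f v"
  using assms(1)
proof induction
  case (const a) then show ?case by simp
next
  case (linear l) then show ?case using assms(3) by simp
next
  case (add d f g) then show ?case by (simp add: distrib_left)
next
  case (mult d f e g) then show ?case by (simp add: power_add)
qed

lemma form_const_mult:
  assumes "form s V d f" shows "form s V d (\<lambda>v. a * f v)"
  using form.mult[OF form.const[of s V a] assms] by simp

lemma form_diff:
  assumes "form s V d f" "form s V d g" shows "form s V d (\<lambda>v. f v - g v)"
  using form.add[OF assms(1) form_const_mult[OF assms(2), of "- 1"]] by simp

lemma form_power:
  assumes "form s V d f" shows "form s V (n * d) (\<lambda>v. f v ^ n)"
proof (induction n)
  case 0 show ?case using form.const[of s V 1] by simp
next
  case (Suc n) show ?case using form.mult[OF assms Suc] by simp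
qed

lemma form_compose_matrix:
  assumes "form (*s) UNIV d F"
  shows "form (*s) UNIV d (\<lambda>x. F ((h :: complex^'n^'m) *v x))"
  using assms
proof induction
  case (const a) then show ?case by (rule form.const)
next
  case (linear l)
  then show ?case
    by (intro form.linear) (simp_all add: matrix_vector_right_distrib vector_scalar_commute)
next
  case (add d f g) then show ?case by (intro form.add)
next
  case (mult d f e g) then show ?case by (intro form.mult)
qed

text \<open>Monomials are indexed by ordered words of variables, not by exponents. Products of forms
  become concatenation, and a word of length d + e splits uniquely with \<open>take\<close> and
  \<open>drop\<close>; coefficients need not be unique.\<close>

definition monomial_at :: "complex^6 \<Rightarrow> 6 list \<Rightarrow> complex" where
  "monomial_at x is = prod_list (map (($) x) is)"

lemma linear_expansion_6:
  fixes l :: "complex^6 \<Rightarrow> complex"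
  assumes add: "\<And>u v. l (u + v) = l u + l v" and scale: "\<And>a v. l (a *s v) = a * l v"
  shows "l x = (\<Sum>i\<in>UNIV. l (axis i 1) * x $ i)"
proof -
  have zero: "l 0 = 0" using scale[of 0 0] by simp
  have "l (\<Sum>i\<in>A. x $ i *s axis i 1) = (\<Sum>i\<in>A. l (axis i 1) * x $ i)" if "finite A" for A
    using that by induction (simp_all add: add scale zero mult.commute)
  then have "l (\<Sum>i\<in>UNIV. x $ i *s axis i 1) = (\<Sum>i\<in>UNIV. l (axis i 1) * x $ i)"
    by simp
  then show ?thesis by (simp only: basis_expansion)
qed

lemma finite_lists_6: "finite {is :: 6 list. length is = d}"
  using finite_lists_length_eq[of "UNIV :: 6 set" d] by simp

lemma form_expansion:
  assumes "form (*s) UNIV d F"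
  shows "\<exists>a. \<forall>x. F x = (\<Sum>is | length is = d. a is * monomial_at x is)"
  using assms
proof induction
  case (const b)
  show ?case by (intro exI[of _ "\<lambda>_. b"]) (simp add: monomial_at_def)
next
  case (linear l)
  have "l x = (\<Sum>is | length is = 1. l (axis (hd is) 1) * monomial_at x is)" for x
  proof -
    have "l x = (\<Sum>i\<in>UNIV. l (axis i 1) * x $ i)"
      using linear by (intro linear_expansion_6) auto
    also have "\<dots> = (\<Sum>is | length is = 1. l (axis (hd is) 1) * monomial_at x is)"
      by (rule sum.reindex_bij_witness[where i = hd and j = "\<lambda>i. [i]"])
         (auto simp: monomial_at_def length_Suc_conv)
    finally show ?thesis .
  qed
  then show ?case by (intro exI[of _ "\<lambda>is. l (axis (hd is) 1)"]) blast
next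
  case (add d f g)
  then obtain a b where "\<And>x. f x = (\<Sum>is | length is = d. a is * monomial_at x is)"
    "\<And>x. g x = (\<Sum>is | length is = d. b is * monomial_at x is)" by blast
  then show ?case
    by (intro exI[of _ "\<lambda>is. a is + b is"]) (simp add: sum.distrib distrib_right)
next
  case (mult d f e g)
  then obtain a b where *: "\<And>x. f x = (\<Sum>is | length is = d. a is * monomial_at x is)"
    "\<And>x. g x = (\<Sum>is | length is = e. b is * monomial_at x is)" by blast
  have "f x * g x = (\<Sum>is | length is = d + e. a (take d is) * b (drop d is) * monomial_at x is)" for x
  proof -
    have "f x * g x = (\<Sum>(is, js) \<in> {is. length is = d} \<times> {js. length js = e}.
        a is * monomial_at x is * (b js * monomial_at x js))"
      unfolding * sum_product sum.cartesian_product ..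
    also have "\<dots> = (\<Sum>is | length is = d + e. a (take d is) * b (drop d is) * monomial_at x is)"
      by (rule sum.reindex_bij_witness[where i = "\<lambda>is. (take d is, drop d is)"
            and j = "\<lambda>(is, js). is @ js"]) (auto simp: monomial_at_def)
    finally show ?thesis .
  qed
  then show ?case by (intro exI[of _ "\<lambda>is. a (take d is) * b (drop d is)"]) blast
qed

text \<open>The span of the cubic monomials of weight 0 modulo 7, with independent coefficients. It
  holds the \<open>g7\<close>-invariants before \<open>g3\<close> is imposed, and also the images of
  invariant cubics under monomial matrices not yet known to preserve invariance.\<close>

definition eight_term :: "complex \<Rightarrow> complex \<Rightarrow> complex \<Rightarrow> complex \<Rightarrow> complex \<Rightarrow> complex \<Rightarrow> complex \<Rightarrow> complex
    \<Rightarrow> complex^6 \<Rightarrow> complex" where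
  "eight_term p1 p2 p3 q1 q2 q3 r s x =
     p1 * ((x$1)\<^sup>2 * x$2) + p2 * ((x$3)\<^sup>2 * x$4) + p3 * ((x$5)\<^sup>2 * x$6)
   + q1 * ((x$2)\<^sup>2 * x$3) + q2 * ((x$4)\<^sup>2 * x$5) + q3 * ((x$6)\<^sup>2 * x$1)
   + r * (x$1 * x$3 * x$5) + s * (x$2 * x$4 * x$6)"

definition is_eight_term :: "(complex^6 \<Rightarrow> complex) \<Rightarrow> bool" where
  "is_eight_term F \<longleftrightarrow> (\<exists>p1 p2 p3 q1 q2 q3 r s. \<forall>x. F x = eight_term p1 p2 p3 q1 q2 q3 r s x)"

lemma is_eight_termI: "(\<And>x. F x = eight_term p1 p2 p3 q1 q2 q3 r s x) \<Longrightarrow> is_eight_term F"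
  unfolding is_eight_term_def by blast

lemma is_eight_term_add:
  assumes "is_eight_term F" "is_eight_term G" shows "is_eight_term (\<lambda>x. F x + G x)"
proof -
  obtain p1 p2 p3 q1 q2 q3 r s where F: "\<And>x. F x = eight_term p1 p2 p3 q1 q2 q3 r s x"
    using assms(1) unfolding is_eight_term_def by blast
  obtain p1' p2' p3' q1' q2' q3' r' s' where G: "\<And>x. G x = eight_term p1' p2' p3' q1' q2' q3' r' s' x"
    using assms(2) unfolding is_eight_term_def by blast
  show ?thesis
    by (rule is_eight_termI[of _ "p1 + p1'" "p2 + p2'" "p3 + p3'" "q1 + q1'" "q2 + q2'" "q3 + q3'" "r + r'" "s + s'"])
       (simp add: F G eight_term_def algebra_simps)
qed

lemma is_eight_term_sum:
  assumes "finite A" "\<And>i. i \<in> A \<Longrightarrow> is_eight_term (F i)"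
  shows "is_eight_term (\<lambda>x. \<Sum>i\<in>A. F i x)"
  using assms
proof induction
  case empty
  show ?case by (rule is_eight_termI[of _ 0 0 0 0 0 0 0 0]) (simp add: eight_term_def)
next
  case (insert i A)
  then show ?case by (simp add: is_eight_term_add)
qed

text \<open>A finite check: of the 216 ordered index triples exactly 30 have weight 0 modulo 7, and
  they are the orderings of these eight monomials.\<close>

lemma weight_zero_monomial:
  assumes "7 dvd wt i + wt j + wt k"
  shows "(\<forall>x::complex^6. x$i * x$j * x$k = (x$1)\<^sup>2 * x$2) \<or> (\<forall>x::complex^6. x$i * x$j * x$k = (x$3)\<^sup>2 * x$4)
    \<or> (\<forall>x::complex^6. x$i * x$j * x$k = (x$5)\<^sup>2 * x$6) \<or> (\<forall>x::complex^6. x$i * x$j * x$k = (x$2)\<^sup>2 * x$3)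
    \<or> (\<forall>x::complex^6. x$i * x$j * x$k = (x$4)\<^sup>2 * x$5) \<or> (\<forall>x::complex^6. x$i * x$j * x$k = (x$6)\<^sup>2 * x$1)
    \<or> (\<forall>x::complex^6. x$i * x$j * x$k = x$1 * x$3 * x$5) \<or> (\<forall>x::complex^6. x$i * x$j * x$k = x$2 * x$4 * x$6)"
proof -
  have small: "\<not> 7 dvd (3::nat)" "\<not> 7 dvd (2::nat)" "(1 + 1::nat) = 2" "2 + 1 = (3::nat)"
    by simp_all
  show ?thesis
    using assms exhaust_6[of i] exhaust_6[of j] exhaust_6[of k]
    apply (elim disjE)
    apply (simp_all only: wt_simps small simp_thms power2_eq_square mult_ac)
    apply (simp_all del: One_nat_def mult_cancel_left mult_cancel_right)
    done
qed

lemma is_eight_term_monomial: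
  assumes "7 dvd wt i + wt j + wt k" shows "is_eight_term (\<lambda>x. c * (x$i * x$j * x$k))"
  using weight_zero_monomial[OF assms]
  apply (elim disjE)
         apply (rule is_eight_termI[of _ c 0 0 0 0 0 0 0], simp add: eight_term_def)
        apply (rule is_eight_termI[of _ 0 c 0 0 0 0 0 0], simp add: eight_term_def)
       apply (rule is_eight_termI[of _ 0 0 c 0 0 0 0 0], simp add: eight_term_def)
      apply (rule is_eight_termI[of _ 0 0 0 c 0 0 0 0], simp add: eight_term_def)
     apply (rule is_eight_termI[of _ 0 0 0 0 c 0 0 0], simp add: eight_term_def)
    apply (rule is_eight_termI[of _ 0 0 0 0 0 c 0 0], simp add: eight_term_def)
   apply (rule is_eight_termI[of _ 0 0 0 0 0 0 c 0], simp add: eight_term_def)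
  apply (rule is_eight_termI[of _ 0 0 0 0 0 0 0 c], simp add: eight_term_def)
  done

text \<open>Averaging over the powers of \<open>g7\<close> kills every monomial whose weight is nonzero modulo 7.\<close>

lemma g7_invariant_cubic:
  assumes "form (*s) UNIV 3 F" and inv: "\<And>x. F (g7 *v x) = F x"
  shows "is_eight_term F"
proof -
  obtain a where a: "\<And>x. F x = (\<Sum>is | length is = 3. a is * monomial_at x is)"
    using form_expansion[OF assms(1)] by blast
  define y :: "nat \<Rightarrow> complex^6 \<Rightarrow> complex^6" where "y n x = (\<chi> i. \<zeta> ^ (n * wt i) * x $ i)" for n x
  have Fy: "F (y n x) = F x" for n x
  proof (induction n)
    case 0 then show ?case by (simp add: y_def)
  next
    case (Suc n)
    have "y (Suc n) x = g7 *v y n x" by (simp add: vec_eq_iff g7_mult y_def power_add)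
    then show ?case using Suc inv by simp
  qed
  have mono: "monomial_at (y n x) is = \<zeta> ^ (n * sum_list (map wt is)) * monomial_at x is" for n x "is"
    by (induction "is") (simp_all add: monomial_at_def y_def power_add distrib_left)
  have "7 * F x = (\<Sum>n<7. F (y n x))" for x by (simp add: Fy)
  also have "(\<Sum>n<7. F (y n x)) =
      (\<Sum>is | length is = 3. a is * monomial_at x is * (\<Sum>n<7. \<zeta> ^ (n * sum_list (map wt is))))" for x
    unfolding a mono by (subst sum.swap) (simp add: sum_distrib_left mult_ac)
  also have "(\<Sum>is | length is = 3. a is * monomial_at x is * (\<Sum>n<7. \<zeta> ^ (n * sum_list (map wt is)))) =
      7 * (\<Sum>is | length is = 3. a is * monomial_at x is *
      (if 7 dvd sum_list (map wt is) then 1 else 0))" for x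
    unfolding \<zeta>_sum sum_distrib_left by (rule sum.cong) auto
  finally have F7: "F x = (\<Sum>is | length is = 3. a is * monomial_at x is *
      (if 7 dvd sum_list (map wt is) then 1 else 0))" for x
    by simp
  have "is_eight_term (\<lambda>x. \<Sum>is | length is = 3. a is * monomial_at x is *
      (if 7 dvd sum_list (map wt is) then 1 else 0))"
  proof (rule is_eight_term_sum[OF finite_lists_6])
    fix "is" :: "6 list" assume "is \<in> {is. length is = 3}"
    then obtain i j k where ijk: "is = [i, j, k]" by (auto simp: numeral_3_eq_3 length_Suc_conv)
    show "is_eight_term (\<lambda>x. a is * monomial_at x is * (if 7 dvd sum_list (map wt is) then 1 else 0))"
    proof (cases "7 dvd wt i + wt j + wt k")
      case True
      then show ?thesis using is_eight_term_monomial[OF True, of "a is"]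
        by (simp add: ijk monomial_at_def mult_ac add_ac)
    next
      case False
      then show ?thesis
        by (intro is_eight_termI[of _ 0 0 0 0 0 0 0 0]) (simp add: ijk eight_term_def add_ac)
    qed
  qed
  then show ?thesis by (simp add: F7[symmetric])
qed

lemma eight_term_g3:
  "eight_term p1 p2 p3 q1 q2 q3 r s (g3 *v x) = eight_term p2 p3 p1 q2 q3 q1 r s x"
  by (simp add: eight_term_def g3_mult wrap_6 algebra_simps)

text \<open>The supports of the eight monomials form an antichain, so the indicator vector of one
  support kills the seven others.\<close>

lemma eight_term_inject:
  assumes "\<And>x. eight_term p1 p2 p3 q1 q2 q3 r s x = eight_term p1' p2' p3' q1' q2' q3' r' s' x"
  shows "p1 = p1'" "p2 = p2'" "p3 = p3'" "q1 = q1'" "q2 = q2'" "q3 = q3'" "r = r'" "s = s'"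
  using assms[of "vector [1, 1, 0, 0, 0, 0]"] assms[of "vector [0, 0, 1, 1, 0, 0]"]
    assms[of "vector [0, 0, 0, 0, 1, 1]"] assms[of "vector [0, 1, 1, 0, 0, 0]"]
    assms[of "vector [0, 0, 0, 1, 1, 0]"] assms[of "vector [1, 0, 0, 0, 0, 1]"]
    assms[of "vector [1, 0, 1, 0, 1, 0]"] assms[of "vector [0, 1, 0, 1, 0, 1]"]
  by (simp_all add: eight_term_def)

lemma cubic_eight_term: "cubic c1 c2 c3 c4 = eight_term c1 c1 c1 c2 c2 c2 c3 c4"
  by (simp add: fun_eq_iff cubic_def eight_term_def algebra_simps)

lemma invariant_cubic:
  assumes "form (*s) UNIV 3 F" "\<And>x. F (g7 *v x) = F x" "\<And>x. F (g3 *v x) = F x"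
  shows "\<exists>c1 c2 c3 c4. F = cubic c1 c2 c3 c4"
proof -
  obtain p1 p2 p3 q1 q2 q3 r s where F: "\<And>x. F x = eight_term p1 p2 p3 q1 q2 q3 r s x"
    using g7_invariant_cubic[OF assms(1,2)] unfolding is_eight_term_def by blast
  have "eight_term p2 p3 p1 q2 q3 q1 r s x = eight_term p1 p2 p3 q1 q2 q3 r s x" for x
    using assms(3)[of x] by (simp add: F eight_term_g3)
  from eight_term_inject[OF this] have "F = cubic p1 q1 r s"
    unfolding cubic_eight_term using F by auto
  then show ?thesis by blast
qed

lemma form_component: "form (*s) UNIV 1 (\<lambda>x::complex^'n. x $ i)"
  by (rule form.linear) auto

lemma form_cubic: "form (*s) UNIV 3 (cubic c1 c2 c3 c4)"
proof -
  have 3: "form (*s) UNIV 3 (\<lambda>x::complex^6. x $ i * x $ j * x $ k)" for i j k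
    using form.mult[OF form.mult[OF form_component form_component] form_component, of i j k]
    by (simp add: numeral_3_eq_3)
  have "form (*s) UNIV 3 (eight_term p1 p2 p3 q1 q2 q3 r s)" for p1 p2 p3 q1 q2 q3 r s
    unfolding eight_term_def power2_eq_square
    by (intro form.add form_const_mult 3)
  then show ?thesis by (simp add: cubic_eight_term)
qed

lemma cubic_g7: "cubic c1 c2 c3 c4 (g7 *v x) = cubic c1 c2 c3 c4 x"
proof -
  have *: "(\<zeta> ^ a * u)\<^sup>2 * (\<zeta> ^ b * v) = \<zeta> ^ (2 * a + b) * (u\<^sup>2 * v)"
       "\<zeta> ^ a * u * (\<zeta> ^ b * v) * (\<zeta> ^ c * w) = \<zeta> ^ (a + b + c) * (u * v * w)" for a b c u v w
    by (simp_all add: power_add power_mult power_mult_distrib mult_ac power2_eq_square)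
  have "\<zeta> ^ 14 = 1" using \<zeta>_power_eq_iff[of 14 0] by simp
  then show ?thesis by (simp only: cubic_def g7_mult *) simp
qed

lemma cubic_g3: "cubic c1 c2 c3 c4 (g3 *v x) = cubic c1 c2 c3 c4 x"
  by (simp add: cubic_eight_term eight_term_g3)

lemma F21_invariant:
  assumes "\<And>x. F (g7 *v x) = F x" "\<And>x. F (g3 *v x) = F x" "A \<in> F21"
  shows "F (A *v x) = F x"
  using assms(3) unfolding F21_def
proof (induction arbitrary: x rule: generate.induct)
  case one then show ?case by (simp add: SL6_def)
next
  case (incl h) then show ?case using assms(1,2) by auto
next
  case (inv h)
  then have h: "det h = 1" "\<And>x. F (h *v x) = F x" using assms(1,2) det_g7 det_g3 by auto
  have "F (matrix_inv h *v x) = F (h *v (matrix_inv h *v x))" by (simp add: h)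
  then show ?case using det_1_inv[OF h(1)] inv_SL6[OF h(1)] by (simp add: matrix_vector_mul_assoc)
next
  case (eng h1 h2)
  then show ?case by (simp add: SL6_def flip: matrix_vector_mul_assoc)
qed

lemma F21_det: "A \<in> F21 \<Longrightarrow> det A = 1"
  using F21_subset_carrier carrier_SL6 by blast

lemma V_F21_iff:
  "F \<in> V_F21 \<longleftrightarrow> form (*s) UNIV 3 F \<and> (\<forall>x. F (g7 *v x) = F x) \<and> (\<forall>x. F (g3 *v x) = F x)"
proof
  assume F: "F \<in> V_F21"
  have "F (A *v x) = F x" if "A \<in> F21" for A x
  proof -
    have "F (A *v x) = act A F (A *v x)" using F that by (simp add: V_F21_def)
    then show ?thesis using det_1_inv[OF F21_det[OF that]] by (simp add: act_def matrix_vector_mul_assoc)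
  qed
  then show "form (*s) UNIV 3 F \<and> (\<forall>x. F (g7 *v x) = F x) \<and> (\<forall>x. F (g3 *v x) = F x)"
    using F g7_in_F21 g3_in_F21 by (simp add: V_F21_def)
next
  assume F: "form (*s) UNIV 3 F \<and> (\<forall>x. F (g7 *v x) = F x) \<and> (\<forall>x. F (g3 *v x) = F x)"
  have "act A F = F" if "A \<in> F21" for A
  proof
    fix x
    have "F (matrix_inv A *v x) = F (A *v (matrix_inv A *v x))"
      using F21_invariant[of F A] F that by simp
    then show "act A F x = F x"
      using det_1_inv[OF F21_det[OF that]] by (simp add: act_def matrix_vector_mul_assoc)
  qed
  then show "F \<in> V_F21" using F by (simp add: V_F21_def)
qed

lemma V_F21_eq: "V_F21 = {cubic c1 c2 c3 c4 | c1 c2 c3 c4. True}"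
  using invariant_cubic form_cubic cubic_g7 cubic_g3 by (auto simp: V_F21_iff)

lemma cubic_in_V [simp]: "cubic c1 c2 c3 c4 \<in> V_F21"
  by (auto simp: V_F21_eq)

lemma cubic_inject: "cubic c1 c2 c3 c4 = cubic d1 d2 d3 d4 \<longleftrightarrow> c1 = d1 \<and> c2 = d2 \<and> c3 = d3 \<and> c4 = d4"
  unfolding cubic_eight_term
  using eight_term_inject[of c1 c1 c1 c2 c2 c2 c3 c4 d1 d1 d1 d2 d2 d2 d3 d4] by auto

section \<open>The normalizer acts by monomial substitutions\<close>

lemma G2_det: "A \<in> G2 \<Longrightarrow> det A = 1"
  by (auto simp: G2_iff det_mul det_mat_6 F21_det)

lemma F21_subset_G2: "A \<in> F21 \<Longrightarrow> A \<in> G2"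
  unfolding G2_iff by (intro exI[of _ 1] exI[of _ A]) simp

lemma mat_mult_G2:
  assumes "z ^ 6 = 1" "A \<in> F21" shows "mat z ** A \<in> G2"
  using assms G2_iff by blast

lemma G2_mult:
  assumes "A \<in> G2" "B \<in> G2" shows "A ** B \<in> G2"
proof -
  obtain z A' w B' where A: "z ^ 6 = 1" "A' \<in> F21" "A = mat z ** A'"
    and B: "w ^ 6 = 1" "B' \<in> F21" "B = mat w ** B'" using assms unfolding G2_iff by blast
  have "A ** B = mat z ** (A' ** mat w) ** B'" by (simp add: A B matrix_mul_assoc)
  also have "\<dots> = mat (z * w) ** (A' ** B')"
    by (simp only: mat_commute[of w A', symmetric] matrix_mul_assoc mat_mat_6)
  finally show ?thesis
    using mat_mult_G2[of "z * w" "A' ** B'"] A B by (simp add: power_mult_distrib F21_mult)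
qed

lemma F21_inv:
  assumes "A \<in> F21" shows "matrix_inv A \<in> F21"
proof -
  have "subgroup F21 SL6" unfolding F21_def
    by (rule group.generate_is_subgroup[OF group_SL6]) (auto simp: carrier_SL6 det_g7 det_g3)
  from subgroup.m_inv_closed[OF this assms] show ?thesis
    by (simp add: inv_SL6 F21_det assms)
qed

lemma G2_inv:
  assumes "A \<in> G2" shows "matrix_inv A \<in> G2"
proof -
  obtain z A' where A: "z ^ 6 = 1" "A' \<in> F21" "A = mat z ** A'"
    using assms unfolding G2_iff by blast
  then have "z \<noteq> 0" by auto
  have "(mat (1 / z) ** matrix_inv A') ** A = mat (1 / z) ** (matrix_inv A' ** mat z) ** A'"
    by (simp add: A matrix_mul_assoc)
  also have "\<dots> = mat (1 / z * z) ** (matrix_inv A' ** A')"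
    by (simp only: mat_commute[of z "matrix_inv A'", symmetric] matrix_mul_assoc mat_mat_6)
  also have "\<dots> = mat 1" using \<open>z \<noteq> 0\<close> det_1_inv[OF F21_det[OF A(2)]] by simp
  finally have "matrix_inv A = mat (1 / z) ** matrix_inv A'" by (rule matrix_inv_unique)
  then show ?thesis using mat_mult_G2[OF _ F21_inv[OF A(2)], of "1 / z"] A(1) by (simp add: power_divide)
qed

lemma N_iff:
  "g \<in> carrier N \<longleftrightarrow> det g = 1 \<and> (\<lambda>A. g ** A ** matrix_inv g) ` G2 = G2"
proof -
  have "G2 \<subseteq> carrier SL6" using G2_det by (auto simp: carrier_SL6)
  moreover have "g <#\<^bsub>SL6\<^esub> G2 #>\<^bsub>SL6\<^esub> inv\<^bsub>SL6\<^esub> g = (\<lambda>A. g ** A ** matrix_inv g) ` G2" if "det g = 1"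
    unfolding l_coset_def r_coset_def inv_SL6[OF that] by (auto simp: SL6_def)
  ultimately show ?thesis
    by (auto simp: N_def normalizer_def stabilizer_def carrier_SL6)
qed

lemma N_det: "g \<in> carrier N \<Longrightarrow> det g = 1"
  by (simp add: N_iff)

lemma N_conj: "g \<in> carrier N \<Longrightarrow> A \<in> G2 \<Longrightarrow> g ** A ** matrix_inv g \<in> G2"
  by (auto simp: N_iff)

lemma N_conj_inv:
  assumes "g \<in> carrier N" "A \<in> G2" shows "matrix_inv g ** A ** g \<in> G2"
proof -
  obtain B where B: "B \<in> G2" "A = g ** B ** matrix_inv g" using assms by (auto simp: N_iff)
  have "matrix_inv g ** A ** g = (matrix_inv g ** g) ** B ** (matrix_inv g ** g)"
    by (simp add: B matrix_mul_assoc)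
  then show ?thesis using det_1_inv[OF N_det[OF assms(1)]] B(1) by simp
qed

lemma conj_F21_in_G2:
  assumes g: "det g = 1" and gen: "\<And>s. s \<in> {g7, g3} \<Longrightarrow> \<exists>t\<in>G2. g ** s = t ** g" and "A \<in> F21"
  shows "g ** A ** matrix_inv g \<in> G2"
  using assms(3) unfolding F21_def
proof (induction rule: generate.induct)
  case one
  have "mat 1 \<in> G2" by (intro F21_subset_G2 mat_1_in_F21)
  then show ?case using det_1_inv[OF g] by (simp add: SL6_def)
next
  case (incl h)
  then obtain t where "t \<in> G2" "g ** h = t ** g" using gen by blast
  then show ?case using det_1_inv[OF g] by (simp flip: matrix_mul_assoc)
next
  case (inv h)
  then have h: "det h = 1" using det_g7 det_g3 by auto
  obtain t where t: "t \<in> G2" "g ** h = t ** g" using gen inv by blast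
  have "(g ** matrix_inv h ** matrix_inv g) ** t = g ** matrix_inv h ** matrix_inv g ** t ** (g ** matrix_inv g)"
    using det_1_inv[OF g] by simp
  also have "\<dots> = g ** matrix_inv h ** matrix_inv g ** (g ** h) ** matrix_inv g"
    by (simp add: t(2) matrix_mul_assoc)
  also have "\<dots> = g ** matrix_inv h ** (matrix_inv g ** g) ** h ** matrix_inv g"
    by (simp add: matrix_mul_assoc)
  also have "\<dots> = g ** (matrix_inv h ** h) ** matrix_inv g"
    using det_1_inv[OF g] by (simp add: matrix_mul_assoc)
  also have "\<dots> = mat 1" using det_1_inv[OF g] det_1_inv[OF h] by simp
  finally have "matrix_inv t = g ** matrix_inv h ** matrix_inv g" by (rule matrix_inv_unique)
  then show ?case using G2_inv[OF t(1)] inv_SL6[OF h] by simp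
next
  case (eng h1 h2)
  have "g ** (h1 ** h2) ** matrix_inv g = g ** h1 ** (matrix_inv g ** g) ** h2 ** matrix_inv g"
    using det_1_inv[OF g] by (simp add: matrix_mul_assoc)
  also have "\<dots> = (g ** h1 ** matrix_inv g) ** (g ** h2 ** matrix_inv g)"
    by (simp add: matrix_mul_assoc)
  finally show ?case using G2_mult[OF eng.IH] by (simp add: SL6_def)
qed

lemma conj_G2:
  assumes g: "det g = 1" and gen: "\<And>s. s \<in> {g7, g3} \<Longrightarrow> \<exists>t\<in>G2. g ** s = t ** g" and "A \<in> G2"
  shows "g ** A ** matrix_inv g \<in> G2"
proof -
  obtain z B where A: "z ^ 6 = 1" "B \<in> F21" "A = mat z ** B" using assms(3) unfolding G2_iff by blast
  have "g ** A ** matrix_inv g = (g ** mat z) ** B ** matrix_inv g" by (simp add: A matrix_mul_assoc)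
  also have "\<dots> = mat z ** (g ** B ** matrix_inv g)" by (simp add: mat_commute matrix_mul_assoc)
  finally show ?thesis
    using G2_mult[OF mat_mult_G2[OF A(1) mat_1_in_F21] conj_F21_in_G2[OF g gen A(2)]] by simp
qed

text \<open>The conditions on the generators avoid \<open>matrix_inv g\<close>, so that for an
  explicit g they are identities between entries. \<open>left\<close> gives that conjugation by g
  maps \<open>G2\<close> into itself; \<open>right\<close> gives the same for the inverse, hence
  surjectivity.\<close>

lemma in_NI:
  assumes g: "det g = 1"
    and left: "\<And>s. s \<in> {g7, g3} \<Longrightarrow> \<exists>t\<in>G2. g ** s = t ** g"
    and right: "\<And>s. s \<in> {g7, g3} \<Longrightarrow> \<exists>t\<in>G2. s ** g = g ** t"
  shows "g \<in> carrier N"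
proof -
  let ?h = "matrix_inv g"
  have h: "det ?h = 1" "g ** ?h = mat 1" "?h ** g = mat 1" using det_1_inv[OF g] by auto
  have inv_h: "matrix_inv ?h = g" using h(2) by (rule matrix_inv_unique)
  have "\<exists>t\<in>G2. ?h ** s = t ** ?h" if s: "s \<in> {g7, g3}" for s
  proof -
    obtain t where t: "t \<in> G2" "s ** g = g ** t" using right[OF s] by blast
    have "?h ** s = ?h ** (s ** g) ** ?h" using h by (simp flip: matrix_mul_assoc)
    also have "\<dots> = (?h ** g) ** t ** ?h" by (simp add: t matrix_mul_assoc)
    finally show ?thesis using t h by auto
  qed
  then have conj_inv: "?h ** A ** g \<in> G2" if "A \<in> G2" for A
    using conj_G2[OF h(1) _ that] unfolding inv_h by blast
  have "A \<in> (\<lambda>A. g ** A ** ?h) ` G2" if "A \<in> G2" for A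
  proof
    have "g ** (?h ** A ** g) ** ?h = (g ** ?h) ** A ** (g ** ?h)" by (simp add: matrix_mul_assoc)
    then show "A = g ** (?h ** A ** g) ** ?h" using h by simp
  qed (rule conj_inv[OF that])
  then show ?thesis using conj_G2[OF g left] g by (auto simp: N_iff)
qed

lemma funpow_g7: "((*v) g7 ^^ n) x $ i = \<zeta> ^ (n * wt i) * x $ i"
  by (induction n) (simp_all add: g7_mult power_add)

lemma funpow_g7_7: "((*v) g7 ^^ 7) x = x"
  unfolding vec_eq_iff funpow_g7 by (simp add: power_mult)

lemma funpow_g3_3: "((*v) g3 ^^ 3) x = x"
proof -
  have "i - 2 - 2 - 2 = i" for i :: 6 using exhaust_6[of i] by (auto simp: wrap_6)
  then show ?thesis unfolding numeral_3_eq_3 vec_eq_iff by (simp only: funpow.simps o_apply g3_mult id_apply) simp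
qed

lemma semi_invariant_iterate:
  assumes "\<And>x. G (T x) = c * G x" shows "G ((T ^^ n) x) = c ^ n * (G x :: complex)"
  by (induction n) (simp_all add: assms)

text \<open>The conjugates of \<open>g7\<close> and \<open>g3\<close> act on a transformed invariant cubic by a sign \<open>z\<^sup>3\<close>,
  which is trivial because both have odd order.\<close>

lemma act_V_F21:
  assumes g: "g \<in> carrier N" and F: "F \<in> V_F21" shows "act g F \<in> V_F21"
proof -
  let ?h = "matrix_inv g"
  have F': "form (*s) UNIV 3 F" "\<And>A x. A \<in> F21 \<Longrightarrow> F (A *v x) = F x"
    using F F21_invariant[of F] unfolding V_F21_iff by blast+
  have gh: "g ** ?h = mat 1" using det_1_inv[OF N_det[OF g]] by simp
  have semi: "\<exists>e. e\<^sup>2 = 1 \<and> (\<forall>x. F (?h *v (s *v x)) = e * F (?h *v x))" if s: "s \<in> F21" for s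
  proof -
    obtain z B where z: "z ^ 6 = 1" "B \<in> F21" "?h ** s ** g = mat z ** B"
      using N_conj_inv[OF g F21_subset_G2[OF s]] unfolding G2_iff by blast
    have "?h ** s = (?h ** s ** g) ** ?h" using gh by (simp flip: matrix_mul_assoc)
    then have "?h *v (s *v x) = z *s (B *v (?h *v x))" for x
      by (simp add: z matrix_vector_mul_assoc flip: mat_vec_6) (simp add: matrix_mul_assoc)
    then have "F (?h *v (s *v x)) = z ^ 3 * F (?h *v x)" for x
      using form_homogeneous[OF F'(1)] F'(2)[OF z(2)] by simp
    moreover have "(z ^ 3)\<^sup>2 = 1" using z(1) by (simp flip: power_mult)
    ultimately show ?thesis by blast
  qed
  have odd_one: "e ^ 7 = e" "e ^ 3 = e" if "e\<^sup>2 = 1" for e :: complex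
    using that by (simp_all add: power_numeral_reduce power2_eq_square)
  obtain e7 where e7: "e7\<^sup>2 = 1" "\<And>x. F (?h *v (g7 *v x)) = e7 * F (?h *v x)"
    using semi[OF g7_in_F21] by blast
  obtain e3 where e3: "e3\<^sup>2 = 1" "\<And>x. F (?h *v (g3 *v x)) = e3 * F (?h *v x)"
    using semi[OF g3_in_F21] by blast
  have "F (?h *v x) = e7 * F (?h *v x)" for x
    using semi_invariant_iterate[of "\<lambda>x. F (?h *v x)" "(*v) g7" e7 7 x] e7
    by (simp add: funpow_g7_7 odd_one)
  moreover have "F (?h *v x) = e3 * F (?h *v x)" for x
    using semi_invariant_iterate[of "\<lambda>x. F (?h *v x)" "(*v) g3" e3 3 x] e3
    by (simp add: funpow_g3_3 odd_one)
  ultimately show ?thesis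
    unfolding V_F21_iff act_def using form_compose_matrix[OF F'(1)] e7(2) e3(2) by simp
qed

section \<open>Conjugates of \<open>g7\<close> and the monomial shape of the normalizer\<close>

lemma sum_\<zeta>_wt: "(\<Sum>i\<in>UNIV. \<zeta> ^ (n * wt i)) = (if 7 dvd n then 6 else - 1)"
proof -
  have "(\<Sum>k<7. \<zeta> ^ (k * n)) = 1 + (\<Sum>i\<in>UNIV. \<zeta> ^ (n * wt i))"
    by (simp only: sum_6 wt_simps) (simp add: numeral_eq_Suc algebra_simps del: power_Suc)
  then show ?thesis unfolding \<zeta>_sum by (auto simp: eq_neg_iff_add_eq_0 add.commute split: if_splits)
qed

lemma trace_mat_shift_diag:
  "trace (mat z ** shift_diag n p) = (if p = 0 then z * (if 7 dvd n then 6 else - 1) else 0)"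
proof (cases "p = 0")
  case True
  then have "trace (mat z ** shift_diag n p) = z * (\<Sum>i\<in>UNIV. \<zeta> ^ (n * wt i))"
    unfolding trace_def mat_mult_entry sum_distrib_left by (intro sum.cong) (auto simp: shift_diag_def)
  then show ?thesis using True by (simp add: sum_\<zeta>_wt)
next
  case False
  then have "shift_diag n p $ i $ i = 0" for i
    by (simp add: shift_diag_def eq_diff_eq)
  then show ?thesis using False unfolding trace_def mat_mult_entry by simp
qed

text \<open>In normal form a proper shift has trace 0, a scalar z has trace 6z, and z times a
  nontrivial power of \<open>g7\<close> has trace -z. The conjugate inherits the trace -1 of
  \<open>g7\<close>; since z is a sixth root of unity, 6z = -1 is impossible, and only the last kind
  with z = 1 remains.\<close>

lemma N_conj_g7:
  assumes g: "g \<in> carrier N"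
  shows "\<exists>n. \<not> 7 dvd n \<and> g ** g7 ** matrix_inv g = shift_diag n 0"
proof -
  let ?h = "matrix_inv g"
  obtain z B where z: "z ^ 6 = 1" "B \<in> F21" and conj: "g ** g7 ** ?h = mat z ** B"
    using N_conj[OF g F21_subset_G2[OF g7_in_F21]] unfolding G2_iff by blast
  obtain n p where B: "B = shift_diag n p" using F21_subset_list[OF z(2)] unfolding F21_list_def by blast
  have "trace (g ** g7 ** ?h) = trace (?h ** g ** g7)"
    by (metis trace_mul_sym matrix_mul_assoc)
  also have "\<dots> = trace (mat 1 ** shift_diag 1 0)"
    using det_1_inv[OF N_det[OF g]] by (simp add: g7_shift_diag)
  also have "\<dots> = - 1" unfolding trace_mat_shift_diag by simp
  finally have tr: "(if p = 0 then z * (if 7 dvd n then 6 else - 1) else 0) = - 1"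
    unfolding conj B trace_mat_shift_diag .
  then have "p = 0" by (auto split: if_splits)
  moreover have n: "\<not> 7 dvd n"
  proof
    assume "7 dvd n"
    then have "z * 6 = - 1" using tr by (auto split: if_splits)
    then have "(z * 6) ^ 6 = 1" by simp
    then show False using z(1) by (simp add: power_mult_distrib)
  qed
  ultimately have "z = 1" using tr by simp
  then show ?thesis using conj B \<open>p = 0\<close> n by auto
qed

lemma weight_multiple_shift:
  assumes "\<not> 7 dvd n"
  shows "\<exists>m. \<forall>r k. wt r mod 7 = (n * wt k) mod 7 \<longrightarrow> r = k + m"
proof -
  define j where "j = n mod 7"
  have "j < 7" "j \<noteq> 0" using assms by (auto simp: j_def dvd_eq_mod_eq_0)
  then have "j = 1 \<or> j = 2 \<or> j = 3 \<or> j = 4 \<or> j = 5 \<or> j = 6" by linarith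
  moreover have "(n * w) mod 7 = (j * w) mod 7" for w by (simp add: j_def mod_mult_left_eq)
  \<comment> \<open>The witnesses are the discrete logarithms of 1, ..., 6 to the base 5 modulo 7,
    with 6 standing for 0.\<close>
  ultimately show ?thesis
    apply (elim disjE; simp only:)
    apply (rule exI[of _ 6], simp add: forall_6 wrap_6)
    apply (rule exI[of _ 4], simp add: forall_6 wrap_6)
    apply (rule exI[of _ 5], simp add: forall_6 wrap_6)
    apply (rule exI[of _ 2], simp add: forall_6 wrap_6)
    apply (rule exI[of _ 1], simp add: forall_6 wrap_6)
    apply (rule exI[of _ 3], simp add: forall_6 wrap_6)
    done
qed

text \<open>Comparing entries in \<open>g7 h = h g7^n\<close>, for h the inverse of g, forces an
  entry at r, k to vanish unless \<open>wt r\<close> is n times \<open>wt k\<close> modulo 7, which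
  is a shift. The inverse is described because it is what \<open>act\<close> substitutes.\<close>

lemma N_inv_monomial:
  assumes g: "g \<in> carrier N"
  shows "\<exists>l m. (\<forall>r k. matrix_inv g $ r $ k = (if r = k + m then l k else 0)) \<and> (\<Prod>k\<in>UNIV. l k)\<^sup>2 = 1"
proof -
  let ?h = "matrix_inv g"
  obtain n where n: "\<not> 7 dvd n" "g ** g7 ** ?h = shift_diag n 0" using N_conj_g7[OF g] by blast
  have h: "det ?h = 1" "?h ** g = mat 1" using det_1_inv[OF N_det[OF g]] by auto
  have comm: "shift_diag 1 0 ** ?h = ?h ** shift_diag n 0"
    unfolding n(2)[symmetric] g7_shift_diag[symmetric] matrix_mul_assoc h(2) by simp
  have "\<zeta> ^ wt r * ?h $ r $ k = ?h $ r $ k * \<zeta> ^ (n * wt k)" for r k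
  proof -
    have "(shift_diag 1 0 ** ?h) $ r $ k = \<zeta> ^ wt r * ?h $ r $ k"
      by (simp add: matrix_matrix_mult_def shift_diag_def if_distrib[where f="\<lambda>u. u * _"] sum.delta cong: if_cong)
    moreover have "(?h ** shift_diag n 0) $ r $ k = ?h $ r $ k * \<zeta> ^ (n * wt k)"
      by (simp add: matrix_matrix_mult_def shift_diag_def if_distrib[where f="\<lambda>u. _ * u"] sum.delta' cong: if_cong)
    ultimately show ?thesis using comm by metis
  qed
  then have "?h $ r $ k = 0 \<or> wt r mod 7 = (n * wt k) mod 7" for r k
    using \<zeta>_power_eq_iff[of "wt r" "n * wt k"] by (metis mult.commute mult_cancel_left)
  then obtain m where m: "\<And>r k. r \<noteq> k + m \<Longrightarrow> ?h $ r $ k = 0"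
    using weight_multiple_shift[OF n(1)] by metis
  define l where "l k = ?h $ (k + m) $ k" for k
  have hl: "?h $ r $ k = (if r = k + m then l k else 0)" for r k
    using m[of r k] by (auto simp: l_def)
  \<comment> \<open>Multiplying by the transpose cancels the permutation, so the squared determinant
    is the product of the squared entries, whatever the sign of the shift.\<close>
  have "(?h ** transpose ?h) $ r $ s = (if r = s then (l (r - m))\<^sup>2 else 0)" for r s
  proof -
    have eq: "(i = k + m) = (k = i - m)" for i k :: 6 by (metis add_diff_cancel diff_add_cancel)
    show ?thesis
      by (simp add: matrix_matrix_mult_def transpose_def hl eq if_distrib[where f="\<lambda>u. u * _"]
         power2_eq_square sum.delta cong: if_cong)
  qed
  then have "det (?h ** transpose ?h) = (\<Prod>r\<in>UNIV. (l (r - m))\<^sup>2)"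
    by (subst det_diagonal) auto
  also have "\<dots> = (\<Prod>k\<in>UNIV. (l k)\<^sup>2)"
    by (rule prod.reindex_bij_witness[where i = "\<lambda>k. k + m" and j = "\<lambda>r. r - m"]) auto
  finally have "(\<Prod>k\<in>UNIV. l k)\<^sup>2 = 1" by (simp add: det_mul h(1) det_transpose prod_power_distrib)
  then show ?thesis using hl by blast
qed

lemma monomial_mult:
  fixes h :: "complex^6^6"
  assumes "\<And>r k. h $ r $ k = (if r = k + m then l k else 0)"
  shows "(h *v x) $ r = l (r - m) * x $ (r - m)"
proof -
  have eq: "(r = k + m) = (k = r - m)" for k by (metis add_diff_cancel diff_add_cancel)
  show ?thesis
    by (simp add: matrix_vector_mult_def assms eq if_distrib[where f="\<lambda>u. u * _"] sum.delta cong: if_cong)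
qed

lemma cubic_monomial_mult:
  fixes h :: "complex^6^6"
  assumes h: "\<And>r k. h $ r $ k = (if r = k + m then l k else 0)"
  shows "m \<in> {2, 4, 6} \<Longrightarrow> cubic c1 c2 c3 c4 (h *v x) =
      eight_term ((l 1)\<^sup>2 * l 2 * c1) ((l 3)\<^sup>2 * l 4 * c1) ((l 5)\<^sup>2 * l 6 * c1)
        ((l 2)\<^sup>2 * l 3 * c2) ((l 4)\<^sup>2 * l 5 * c2) ((l 6)\<^sup>2 * l 1 * c2) (l 1 * l 3 * l 5 * c3) (l 2 * l 4 * l 6 * c4) x"
    and "m \<in> {1, 3, 5} \<Longrightarrow> cubic c1 c2 c3 c4 (h *v x) =
      eight_term ((l 1)\<^sup>2 * l 2 * c2) ((l 3)\<^sup>2 * l 4 * c2) ((l 5)\<^sup>2 * l 6 * c2)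
        ((l 2)\<^sup>2 * l 3 * c1) ((l 4)\<^sup>2 * l 5 * c1) ((l 6)\<^sup>2 * l 1 * c1) (l 1 * l 3 * l 5 * c4) (l 2 * l 4 * l 6 * c3) x"
  unfolding cubic_eight_term eight_term_def monomial_mult[OF h]
  by (elim insertE emptyE; hypsubst; simp add: wrap_6 power_mult_distrib algebra_simps)+

definition rescales :: "complex \<Rightarrow> complex \<Rightarrow> complex \<Rightarrow> complex \<Rightarrow> complex^6^6 \<Rightarrow> bool" where
  "rescales \<alpha> \<beta> \<gamma> \<delta> g \<longleftrightarrow>
     (\<forall>c1 c2 c3 c4. act g (cubic c1 c2 c3 c4) = cubic (\<alpha> * c1) (\<beta> * c2) (\<gamma> * c3) (\<delta> * c4))"

definition swaps :: "complex \<Rightarrow> complex \<Rightarrow> complex \<Rightarrow> complex \<Rightarrow> complex^6^6 \<Rightarrow> bool" where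
  "swaps \<alpha> \<beta> \<gamma> \<delta> g \<longleftrightarrow>
     (\<forall>c1 c2 c3 c4. act g (cubic c1 c2 c3 c4) = cubic (\<alpha> * c2) (\<beta> * c1) (\<gamma> * c4) (\<delta> * c3))"

text \<open>Multiplying the three expressions for \<alpha> squares the odd entries, and for \<beta>
  the even ones; this is the source of the cubic relations. The equations for \<open>l\<close> are
  passed on as well, since bounding a stabilizer requires the entries themselves.\<close>

lemma act_cubic_cases:
  assumes g: "g \<in> carrier N"
  obtains l m \<alpha> \<beta> \<gamma> \<delta> where
    "\<And>r k. matrix_inv g $ r $ k = (if r = k + m then l k else 0)" "\<And>k. l k \<noteq> 0"
    "(l 1)\<^sup>2 * l 2 = \<alpha>" "(l 3)\<^sup>2 * l 4 = \<alpha>" "(l 5)\<^sup>2 * l 6 = \<alpha>"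
    "(l 2)\<^sup>2 * l 3 = \<beta>" "(l 4)\<^sup>2 * l 5 = \<beta>" "(l 6)\<^sup>2 * l 1 = \<beta>"
    "\<alpha> ^ 3 = \<gamma>\<^sup>2 * \<delta>" "\<beta> ^ 3 = \<gamma> * \<delta>\<^sup>2" "(\<gamma> * \<delta>)\<^sup>2 = 1"
    "rescales \<alpha> \<beta> \<gamma> \<delta> g \<or> swaps \<alpha> \<beta> \<gamma> \<delta> g"
proof -
  obtain l m where h: "\<And>r k. matrix_inv g $ r $ k = (if r = k + m then l k else 0)"
    and prod_l: "(\<Prod>k\<in>UNIV. l k)\<^sup>2 = 1" using N_inv_monomial[OF g] by blast
  note mult = cubic_monomial_mult[OF h]
  \<comment> \<open>One test form containing both triples suffices: its image is again an invariant
    cubic, so the three coefficients within each triple agree, and this yields the equations on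
    \<open>l\<close>.\<close>
  obtain d1 d2 d3 d4 where "act g (cubic 1 1 0 0) = cubic d1 d2 d3 d4"
    using act_V_F21[OF g cubic_in_V] unfolding V_F21_eq by blast
  then have d: "cubic 1 1 0 0 (matrix_inv g *v x) = eight_term d1 d1 d1 d2 d2 d2 d3 d4 x" for x
    by (metis act_def cubic_eight_term)
  have m: "m \<in> {2, 4, 6} \<or> m \<in> {1, 3, 5}" using exhaust_6[of m] by auto
  define \<alpha> \<beta> \<gamma> \<delta> where "\<alpha> = (l 1)\<^sup>2 * l 2" "\<beta> = (l 2)\<^sup>2 * l 3" "\<gamma> = l 1 * l 3 * l 5" "\<delta> = l 2 * l 4 * l 6"
  note defs = this
  have eqs: "(l 3)\<^sup>2 * l 4 = \<alpha>" "(l 5)\<^sup>2 * l 6 = \<alpha>" "(l 4)\<^sup>2 * l 5 = \<beta>" "(l 6)\<^sup>2 * l 1 = \<beta>"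
  proof -
    have "(l 3)\<^sup>2 * l 4 = \<alpha> \<and> (l 5)\<^sup>2 * l 6 = \<alpha> \<and> (l 4)\<^sup>2 * l 5 = \<beta> \<and> (l 6)\<^sup>2 * l 1 = \<beta>"
      using m
    proof
      assume "m \<in> {2, 4, 6}"
      from eight_term_inject[OF trans[OF mult(1)[OF this, symmetric] d]] show ?thesis by (simp add: defs)
    next
      assume "m \<in> {1, 3, 5}"
      from eight_term_inject[OF trans[OF mult(2)[OF this, symmetric] d]] show ?thesis by (simp add: defs)
    qed
    then show "(l 3)\<^sup>2 * l 4 = \<alpha>" "(l 5)\<^sup>2 * l 6 = \<alpha>" "(l 4)\<^sup>2 * l 5 = \<beta>" "(l 6)\<^sup>2 * l 1 = \<beta>" by auto
  qed
  have "rescales \<alpha> \<beta> \<gamma> \<delta> g \<or> swaps \<alpha> \<beta> \<gamma> \<delta> g"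
    using m
  proof
    assume "m \<in> {2, 4, 6}"
    then have "rescales \<alpha> \<beta> \<gamma> \<delta> g"
      unfolding rescales_def act_def mult(1)[OF \<open>m \<in> {2, 4, 6}\<close>] eqs by (simp add: defs fun_eq_iff cubic_eight_term)
    then show ?thesis ..
  next
    assume "m \<in> {1, 3, 5}"
    then have "swaps \<alpha> \<beta> \<gamma> \<delta> g"
      unfolding swaps_def act_def mult(2)[OF \<open>m \<in> {1, 3, 5}\<close>] eqs by (simp add: defs fun_eq_iff cubic_eight_term)
    then show ?thesis ..
  qed
  moreover have "l k \<noteq> 0" for k
    using prod_l exhaust_6[of k] by (auto simp: prod_6)
  moreover have "\<alpha> ^ 3 = \<gamma>\<^sup>2 * \<delta>"
  proof -
    have "\<alpha> ^ 3 = ((l 1)\<^sup>2 * l 2) * ((l 3)\<^sup>2 * l 4) * ((l 5)\<^sup>2 * l 6)" unfolding eqs defs(1) by (simp add: power3_eq_cube)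
    then show ?thesis by (simp add: defs(3,4) power2_eq_square mult_ac)
  qed
  moreover have "\<beta> ^ 3 = \<gamma> * \<delta>\<^sup>2"
  proof -
    have "\<beta> ^ 3 = ((l 2)\<^sup>2 * l 3) * ((l 4)\<^sup>2 * l 5) * ((l 6)\<^sup>2 * l 1)" unfolding eqs defs(2) by (simp add: power3_eq_cube)
    then show ?thesis by (simp add: defs(3,4) power2_eq_square mult_ac)
  qed
  moreover have "(\<gamma> * \<delta>)\<^sup>2 = 1" using prod_l by (simp add: defs prod_6 mult_ac)
  ultimately show thesis
    by - (rule that[OF h _ defs(1)[symmetric] eqs(1,2) defs(2)[symmetric] eqs(3,4)], assumption+)
qed

section \<open>Elements of the normalizer\<close>

text \<open>Lets the action of an explicit matrix be computed by substituting the matrix itself,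
  without its inverse.\<close>

lemma act_eqI:
  assumes "det g = 1" "\<And>x. F x = G (g *v x)" shows "act g F = G"
  using assms det_1_inv[of g] by (simp add: act_def fun_eq_iff matrix_vector_mul_assoc)

text \<open>The torus element with parameter a, twisted by a cube root of unity w. The twist
  commutes with \<open>g3\<close> only up to the scalar w, which lies in \<open>mu6\<close>, and it
  changes \<open>c1 * c2\<close> by w: exactly the ambiguity left when only the cube of this product
  is known.\<close>

definition torus_vec :: "complex \<Rightarrow> complex \<Rightarrow> complex^6" where
  "torus_vec a w = vector [a, 1 / a, a * w, w / a, a * w\<^sup>2, w\<^sup>2 / a]"

definition torus_elt :: "complex \<Rightarrow> complex \<Rightarrow> complex^6^6" where
  "torus_elt a w = (\<chi> i j. if i = j then torus_vec a w $ i else 0)"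

lemma torus_mult_left: "(torus_elt a w ** A) $ i $ j = torus_vec a w $ i * A $ i $ j"
  by (simp add: torus_elt_def matrix_matrix_mult_def if_distrib[where f="\<lambda>u. u * _"] sum.delta cong: if_cong)

lemma torus_mult_right: "(A ** torus_elt a w) $ i $ j = A $ i $ j * torus_vec a w $ j"
  by (simp add: torus_elt_def matrix_matrix_mult_def if_distrib[where f="\<lambda>u. _ * u"] sum.delta' cong: if_cong)

lemma torus_mult_vec: "(torus_elt a w *v x) $ i = torus_vec a w $ i * x $ i"
  by (simp add: torus_elt_def matrix_vector_mult_def if_distrib[where f="\<lambda>u. u * _"] sum.delta cong: if_cong)

lemma torus_vec_shift:
  assumes "a \<noteq> 0" "w ^ 3 = 1" shows "torus_vec a w $ (j + 2) = w * torus_vec a w $ j"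
  using assms exhaust_6[of j]
  by (auto simp: torus_vec_def wrap_6 power2_eq_square power3_eq_cube field_simps)

lemma torus_elt_in_N:
  assumes a: "a \<noteq> 0" and w: "w ^ 3 = 1" shows "torus_elt a w \<in> carrier N"
proof (rule in_NI)
  let ?g = "torus_elt a w"
  have "w \<noteq> 0" using w by auto
  have "det ?g = (\<Prod>i\<in>UNIV. torus_vec a w $ i)"
    by (subst det_diagonal) (auto simp: torus_elt_def)
  also have "\<dots> = (w ^ 3)\<^sup>2" using a by (simp add: prod_6 torus_vec_def field_simps power_numeral_reduce)
  finally show "det ?g = 1" using w by simp
  have 7: "?g ** g7 = g7 ** ?g"
    by (auto simp: vec_eq_iff torus_mult_left torus_mult_right g7_entry)
  have 3: "?g ** g3 = (mat w ** g3) ** ?g"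
    using torus_vec_shift[OF a w]
    by (simp add: vec_eq_iff torus_mult_left torus_mult_right mat_mult_entry) (simp add: g3_def)
  have inv3: "g3 ** ?g = ?g ** (mat (1 / w) ** g3)"
    using torus_vec_shift[OF a w] \<open>w \<noteq> 0\<close>
    by (simp add: vec_eq_iff torus_mult_left torus_mult_right mat_mult_entry) (simp add: g3_def)
  have "w ^ 6 = (w ^ 3)\<^sup>2" by (simp flip: power_mult)
  then have "w ^ 6 = 1" "(1 / w) ^ 6 = 1" using w by (simp_all add: power_divide)
  note mem = F21_subset_G2[OF g7_in_F21] this[THEN mat_mult_G2[OF _ g3_in_F21]]
  fix s :: "complex^6^6" assume "s \<in> {g7, g3}"
  then show "\<exists>t\<in>G2. ?g ** s = t ** ?g" using 7 3 mem by auto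
  show "\<exists>t\<in>G2. s ** ?g = ?g ** t"
    using \<open>s \<in> {g7, g3}\<close> 7[symmetric] inv3 mem by auto
qed

lemma act_torus_elt:
  assumes a: "a \<noteq> 0" and w: "w ^ 3 = 1"
  shows "act (torus_elt a w) (cubic (a * c1) (w / a * c2) (a ^ 3 * c3) (c4 / a ^ 3)) = cubic c1 c2 c3 c4"
proof (rule act_eqI)
  show "det (torus_elt a w) = 1" using torus_elt_in_N[OF assms] N_det by blast
  fix x
  have w3: "w * (w * w) = 1" using w by (simp add: power3_eq_cube mult.assoc)
  then have w': "w * (w * (w * u)) = u" for u
    by (simp flip: mult.assoc)
  \<comment> \<open>Within each triple the exponents of w agree modulo 3. The powers are left as
    nested products so that \<open>w'\<close> removes three factors at a time.\<close>
  have "cubic c1 c2 c3 c4 (torus_elt a w *v x) =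
    eight_term (a * c1) (a * (w * (w * (w * c1)))) (a * (w * (w * (w * (w * (w * (w * c1)))))))
      (w / a * c2) (w * (w * (w * (w / a * c2)))) (w * (w * (w * (w / a * c2))))
      (a ^ 3 * (w * (w * (w * c3)))) (w * (w * (w * c4)) / a ^ 3) x"
    using a by (simp add: cubic_def eight_term_def torus_mult_vec torus_vec_def field_simps power2_eq_square power3_eq_cube)
  then show "cubic (a * c1) (w / a * c2) (a ^ 3 * c3) (c4 / a ^ 3) x = cubic c1 c2 c3 c4 (torus_elt a w *v x)"
    unfolding w' cubic_eight_term by simp
qed

text \<open>The shift by 3 exchanges odd and even indices. As 5^3 = -1 modulo 7 it inverts
  \<open>g7\<close>, and it commutes with \<open>g3\<close>; for s = 1 it is an involution.\<close>

definition swap_elt :: "complex \<Rightarrow> complex^6^6" where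
  "swap_elt s = (\<chi> i j. if j = i - 3 then s else 0)"

lemma swap_mult_left: "(swap_elt s ** A) $ i $ j = s * A $ (i - 3) $ j"
  by (simp add: swap_elt_def matrix_matrix_mult_def if_distrib[where f="\<lambda>u. u * _"] sum.delta cong: if_cong)

lemma swap_mult_right: "(A ** swap_elt s) $ i $ j = A $ i $ (j + 3) * s"
proof -
  have "(j = k - 3) = (k = j + 3)" for k :: 6 by (metis add_diff_cancel diff_add_cancel)
  then show ?thesis
    by (simp add: swap_elt_def matrix_matrix_mult_def if_distrib[where f="\<lambda>u. _ * u"] sum.delta cong: if_cong)
qed

lemma swap_mult_vec: "(swap_elt s *v x) $ i = s * x $ (i - 3)"
  by (simp add: swap_elt_def matrix_vector_mult_def if_distrib[where f="\<lambda>u. u * _"] sum.delta cong: if_cong)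

lemma swap_elt_eq: "swap_elt s = mat s ** swap_elt 1"
  by (simp add: vec_eq_iff mat_mult_entry) (simp add: swap_elt_def)

lemma det_swap_elt: "det (swap_elt s) = s ^ 6 * det (swap_elt 1)"
  by (subst swap_elt_eq) (simp add: det_mul det_mat_6)

lemma sub_3_6: "(i - 3 = (k :: 6)) = (i = k + 3)" "i - 3 = i + (3 :: 6)" "6 + i = (i :: 6)"
proof -
  show "(i - 3 = k) = (i = k + 3)" by (rule diff_eq_eq)
  show "i - 3 = i + 3" by (simp only: diff_conv_add_uminus wrap_6)
  show "6 + i = i" by (simp flip: wrap_6(6))
qed

lemma det_swap_elt_1: "(det (swap_elt 1))\<^sup>2 = 1"
proof -
  have "i - 3 - 3 = i" for i :: 6 by (simp add: diff_diff_eq flip: wrap_6(6))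
  then have "(swap_elt 1 ** swap_elt 1) $ i $ j = mat 1 $ i $ j" for i j
    unfolding swap_mult_left by (auto simp: swap_elt_def mat_def)
  then have "swap_elt 1 ** swap_elt 1 = mat 1" by (simp add: vec_eq_iff)
  then show ?thesis by (metis det_I det_mul power2_eq_square)
qed

lemma swap_elt_in_N:
  assumes "det (swap_elt s) = 1" shows "swap_elt s \<in> carrier N"
proof (rule in_NI[OF assms])
  let ?g = "swap_elt s"
  have wt: "\<zeta> ^ wt (i + 3) = \<zeta> ^ (6 * wt i)" for i
    unfolding \<zeta>_power_eq_iff using exhaust_6[of i] by (auto simp: wrap_6)
  have 7: "?g ** g7 = shift_diag 6 0 ** ?g" "g7 ** ?g = ?g ** shift_diag 6 0"
    unfolding vec_eq_iff swap_mult_left swap_mult_right g7_shift_diag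
    using wt by (auto simp: shift_diag_def sub_3_6)
  have 3: "?g ** g3 = g3 ** ?g"
    unfolding vec_eq_iff swap_mult_left swap_mult_right by (auto simp: g3_def sub_3_6 algebra_simps)
  have "shift_diag 6 0 \<in> G2" "g3 \<in> G2"
    using F21_subset_G2 F21_inv[OF g7_in_F21] g3_in_F21 by (auto simp: matrix_inv_g7)
  fix u :: "complex^6^6" assume "u \<in> {g7, g3}"
  then show "\<exists>t\<in>G2. ?g ** u = t ** ?g"
    using 7(1) 3 \<open>shift_diag 6 0 \<in> G2\<close> \<open>g3 \<in> G2\<close> by auto
  show "\<exists>t\<in>G2. u ** ?g = ?g ** t"
    using \<open>u \<in> {g7, g3}\<close> 7(2) 3[symmetric] \<open>shift_diag 6 0 \<in> G2\<close> \<open>g3 \<in> G2\<close> by auto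
qed

text \<open>Scaling the permutation by a sixth root of its determinant avoids computing that sign.\<close>

lemma ex_swap:
  obtains g k where "g \<in> carrier N" "k \<noteq> 0"
    "\<And>c1 c2 c3 c4. act g (cubic (k * c2) (k * c1) (k * c4) (k * c3)) = cubic c1 c2 c3 c4"
proof -
  obtain s where s: "det (swap_elt 1) = s ^ 6"
    by (rule exists_complex_root[of 6 "det (swap_elt 1)"]) simp_all
  have det: "det (swap_elt s) = 1"
    using det_swap_elt_1 det_swap_elt[of s] by (simp add: power2_eq_square flip: s)
  then have "s \<noteq> 0" using det_swap_elt[of s] by auto
  have "act (swap_elt s) (cubic (s ^ 3 * c2) (s ^ 3 * c1) (s ^ 3 * c4) (s ^ 3 * c3)) = cubic c1 c2 c3 c4"
    for c1 c2 c3 c4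
    by (rule act_eqI[OF det]) (simp add: cubic_def swap_mult_vec wrap_6 power2_eq_square power3_eq_cube algebra_simps)
  then show thesis using that[OF swap_elt_in_N[OF det], of "s ^ 3"] \<open>s \<noteq> 0\<close> by simp
qed

section \<open>Invariants separate orbits\<close>

text \<open>
  In terms of the torus invariants \<open>A = c\<^sub>1c\<^sub>2\<close>, \<open>B = c\<^sub>3c\<^sub>4\<close>, \<open>C = c\<^sub>1\<^sup>3c\<^sub>4\<close>, \<open>D = c\<^sub>2\<^sup>3c\<^sub>3\<close> these are
  \<open>B\<^sup>2\<close>, \<open>C + D\<close>, \<open>CD\<close> and \<open>A\<^sup>6\<close>.
\<close>

definition E1 :: "complex \<Rightarrow> complex \<Rightarrow> complex \<Rightarrow> complex \<Rightarrow> complex" where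
  "E1 c1 c2 c3 c4 = (c3 * c4)\<^sup>2"
definition E2 :: "complex \<Rightarrow> complex \<Rightarrow> complex \<Rightarrow> complex \<Rightarrow> complex" where
  "E2 c1 c2 c3 c4 = c1 ^ 3 * c4 + c2 ^ 3 * c3"
definition E3 :: "complex \<Rightarrow> complex \<Rightarrow> complex \<Rightarrow> complex \<Rightarrow> complex" where
  "E3 c1 c2 c3 c4 = (c1 ^ 3 * c4) * (c2 ^ 3 * c3)"
definition E4 :: "complex \<Rightarrow> complex \<Rightarrow> complex \<Rightarrow> complex \<Rightarrow> complex" where
  "E4 c1 c2 c3 c4 = ((c1 * c2) ^ 3)\<^sup>2"

lemmas E_defs = E1_def E2_def E3_def E4_def

text \<open>The square of \<open>CD = A^3 B\<close>. It makes \<open>E3\<close> vanish together with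
  \<open>E1\<close> or \<open>E4\<close>, so \<open>E3\<close> need not be listed when simultaneous
  vanishing is excluded.\<close>

lemma E_syzygy: "(E3 c1 c2 c3 c4)\<^sup>2 = E4 c1 c2 c3 c4 * E1 c1 c2 c3 c4"
  by (simp add: E_defs power2_eq_square power3_eq_cube)

lemma E_scale:
  "E1 (t * c1) (t * c2) (t * c3) (t * c4) = t ^ 4 * E1 c1 c2 c3 c4"
  "E2 (t * c1) (t * c2) (t * c3) (t * c4) = t ^ 4 * E2 c1 c2 c3 c4"
  "E3 (t * c1) (t * c2) (t * c3) (t * c4) = (t ^ 4)\<^sup>2 * E3 c1 c2 c3 c4"
  "E4 (t * c1) (t * c2) (t * c3) (t * c4) = (t ^ 4) ^ 3 * E4 c1 c2 c3 c4"
  by (simp_all add: E_defs algebra_simps power_numeral_reduce)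

text \<open>Equality of two points of P(1,1,2,3), from comparing monomials of equal weight. The
  scalar is a ratio in a coordinate of weight 1; if both of these vanish, the syzygy kills the
  coordinate of weight 2, and s is a cube root of the ratio in weight 3.\<close>

lemma weighted_proportional:
  fixes e1 e2 e3 e4 f1 f2 f3 f4 :: complex
  assumes e: "e3\<^sup>2 = e4 * e1" "\<not> (e1 = 0 \<and> e2 = 0 \<and> e4 = 0)"
    and f: "f3\<^sup>2 = f4 * f1" "\<not> (f1 = 0 \<and> f2 = 0 \<and> f4 = 0)"
    and p: "f1 * e2 = e1 * f2" "f1\<^sup>2 * e3 = e1\<^sup>2 * f3" "f2\<^sup>2 * e3 = e2\<^sup>2 * f3"
      "f1 ^ 3 * e4 = e1 ^ 3 * f4" "f2 ^ 3 * e4 = e2 ^ 3 * f4"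
  shows "\<exists>s. s \<noteq> 0 \<and> f1 = s * e1 \<and> f2 = s * e2 \<and> f3 = s\<^sup>2 * e3 \<and> f4 = s ^ 3 * e4"
proof (cases "e1 = 0")
  case False
  then have "f1 \<noteq> 0" using f(2) p(1,4) by auto
  with False have "f1 / e1 \<noteq> 0" "f1 = f1 / e1 * e1" "f2 = f1 / e1 * e2" "f3 = (f1 / e1)\<^sup>2 * e3"
    "f4 = (f1 / e1) ^ 3 * e4"
    using p(1,2,4) by (simp_all add: field_simps)
  then show ?thesis by blast
next
  case e1: True
  show ?thesis
  proof (cases "e2 = 0")
    case False
    have "f1 = 0" using e1 False p(1) by simp
    then have "f2 \<noteq> 0" using f(2) False p(5) by auto
    with False have "f2 / e2 \<noteq> 0" "f2 = f2 / e2 * e2" "f3 = (f2 / e2)\<^sup>2 * e3" "f4 = (f2 / e2) ^ 3 * e4"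
      using p(3,5) by (simp_all add: field_simps)
    then show ?thesis using e1 \<open>f1 = 0\<close> by (metis mult_zero_right)
  next
    case True
    then have "e4 \<noteq> 0" using e1 e(2) by simp
    moreover have "e3 = 0" using e1 e(1) by simp
    moreover have "f1 = 0" "f2 = 0" using e1 True p(4,5) \<open>e4 \<noteq> 0\<close> by simp_all
    moreover have "f3 = 0" "f4 \<noteq> 0" using f \<open>f1 = 0\<close> \<open>f2 = 0\<close> by simp_all
    moreover obtain s where "f4 / e4 = s ^ 3" by (rule exists_complex_root[of 3 "f4 / e4"]) simp_all
    ultimately show ?thesis using e1 True
      by (intro exI[of _ s]) (auto simp: field_simps)
  qed
qed

text \<open>The parameter a is read off a nonzero coordinate: \<open>c1\<close>, else
  \<open>c2\<close>; if both vanish, only \<open>a ^ 3 = c3 / d3\<close> is visible and a cube root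
  is chosen. The matching coordinate of d is nonzero by the invariants: for instance
  \<open>c1\<close> nonzero makes A or C nonzero, hence \<open>d1\<close>.\<close>

lemma torus_orbit_separation:
  fixes c1 c2 c3 c4 d1 d2 d3 d4 w :: complex
  assumes w: "w ^ 3 = 1"
    and ss: "c1 \<noteq> 0 \<or> c3 \<noteq> 0" "c2 \<noteq> 0 \<or> c4 \<noteq> 0"
    and A: "c1 * c2 = w * (d1 * d2)" and B: "c3 * c4 = d3 * d4"
    and C: "c1 ^ 3 * c4 = d1 ^ 3 * d4" and D: "c2 ^ 3 * c3 = d2 ^ 3 * d3"
  shows "\<exists>a. a \<noteq> 0 \<and> c1 = a * d1 \<and> c2 = w / a * d2 \<and> c3 = a ^ 3 * d3 \<and> c4 = d4 / a ^ 3"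
proof -
  have "w \<noteq> 0" using w by auto
  consider "c1 \<noteq> 0" | "c1 = 0" "c2 \<noteq> 0" | "c1 = 0" "c2 = 0" by blast
  then show ?thesis
  proof cases
    case 1
    then have "d1 \<noteq> 0" using ss A C by auto
    define a where "a = c1 / d1"
    have a: "a \<noteq> 0" "c1 = a * d1" using 1 \<open>d1 \<noteq> 0\<close> by (auto simp: a_def)
    have c2: "c2 = w / a * d2" using A a \<open>d1 \<noteq> 0\<close> by (simp add: field_simps)
    have c4: "c4 = d4 / a ^ 3" using C a \<open>d1 \<noteq> 0\<close> by (simp add: field_simps)
    have "c3 = a ^ 3 * d3"
    proof (cases "c4 = 0")
      case True
      \<comment> \<open>With \<open>c4 = 0\<close> the product B says nothing about
        \<open>c3\<close>; but then \<open>c2\<close> is nonzero, and D recovers \<open>c3\<close>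
        because \<open>w ^ 3 = 1\<close>.\<close>
      have "d2 ^ 3 = a ^ 3 * c2 ^ 3" using a(1) by (simp add: c2 power_mult_distrib power_divide w)
      then have "c2 ^ 3 * c3 = c2 ^ 3 * (a ^ 3 * d3)" using D by simp
      then show ?thesis using ss(2) True by simp
    next
      case False
      then show ?thesis using B a c4 by (simp add: field_simps)
    qed
    then show ?thesis using a c2 c4 by blast
  next
    case 2
    then have "c3 \<noteq> 0" using ss by simp
    then have d: "d2 \<noteq> 0" "d3 \<noteq> 0" using 2 D by auto
    then have "d1 = 0" using A 2 \<open>w \<noteq> 0\<close> by simp
    define a where "a = w * d2 / c2"
    have a: "a \<noteq> 0" "c2 = w / a * d2" using 2 d \<open>w \<noteq> 0\<close> by (auto simp: a_def)
    have "d2 ^ 3 = a ^ 3 * c2 ^ 3" using a(1) by (simp add: a(2) power_mult_distrib power_divide w)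
    then have "c2 ^ 3 * c3 = c2 ^ 3 * (a ^ 3 * d3)" using D by simp
    then have c3: "c3 = a ^ 3 * d3" using 2 by simp
    then have "c4 = d4 / a ^ 3" using B a d by (simp add: field_simps)
    then show ?thesis using a c3 2 \<open>d1 = 0\<close> by auto
  next
    case 3
    then have "c3 \<noteq> 0" "c4 \<noteq> 0" using ss by auto
    then have d: "d3 \<noteq> 0" "d4 \<noteq> 0" using B by auto
    then have d': "d1 = 0" "d2 = 0" using C D 3 by auto
    obtain a where a: "c3 / d3 = a ^ 3" by (rule exists_complex_root[of 3 "c3 / d3"]) simp_all
    then have "a \<noteq> 0" "c3 = a ^ 3 * d3" using d \<open>c3 \<noteq> 0\<close> by (auto simp: field_simps)
    moreover from this have "c4 = d4 / a ^ 3" using B d by (simp add: field_simps)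
    ultimately show ?thesis using 3 d' by auto
  qed
qed

text \<open>The sign in \<open>A\<^sup>3 = \<plusminus>A'\<^sup>3\<close>, \<open>B = \<plusminus>B'\<close> is absorbed by a scalar \<open>t\<close> with \<open>t\<^sup>2 = \<plusminus>1\<close>.\<close>

lemma straight_orbit_separation:
  fixes c1 c2 c3 c4 d1 d2 d3 d4 :: complex
  assumes ss: "c1 \<noteq> 0 \<or> c3 \<noteq> 0" "c2 \<noteq> 0 \<or> c4 \<noteq> 0"
    and B: "(c3 * c4)\<^sup>2 = (d3 * d4)\<^sup>2" and A: "((c1 * c2) ^ 3)\<^sup>2 = ((d1 * d2) ^ 3)\<^sup>2"
    and C: "c1 ^ 3 * c4 = d1 ^ 3 * d4" and D: "c2 ^ 3 * c3 = d2 ^ 3 * d3"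
  shows "\<exists>a w t. a \<noteq> 0 \<and> w ^ 3 = 1 \<and> t \<noteq> 0 \<and>
    c1 = a * (t * d1) \<and> c2 = w / a * (t * d2) \<and> c3 = a ^ 3 * (t * d3) \<and> c4 = t * d4 / a ^ 3"
proof -
  \<comment> \<open>The relation \<open>A^3 B = CD\<close> ties the two signs together, so a single
    e serves both; if the signs differ, one of the products is 0 and either sign fits it.\<close>
  have AB: "(c1 * c2) ^ 3 * (c3 * c4) = (d1 * d2) ^ 3 * (d3 * d4)"
  proof -
    have "(c1 * c2) ^ 3 * (c3 * c4) = (c1 ^ 3 * c4) * (c2 ^ 3 * c3)" by (simp add: power_mult_distrib)
    also have "\<dots> = (d1 * d2) ^ 3 * (d3 * d4)" unfolding C D by (simp add: power_mult_distrib)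
    finally show ?thesis .
  qed
  have "c3 * c4 = d3 * d4 \<or> c3 * c4 = - (d3 * d4)" "(c1 * c2) ^ 3 = (d1 * d2) ^ 3 \<or> (c1 * c2) ^ 3 = - ((d1 * d2) ^ 3)"
    using A B by (simp_all only: power2_eq_iff)
  then have "\<exists>e \<in> {1, - 1}. c3 * c4 = e * (d3 * d4) \<and> (c1 * c2) ^ 3 = e * (d1 * d2) ^ 3"
    using AB by (auto simp del: power_mult_distrib)
  then obtain e where e: "e \<in> {1, - 1}" "c3 * c4 = e * (d3 * d4)" "(c1 * c2) ^ 3 = e * (d1 * d2) ^ 3"
    by blast
  \<comment> \<open>As \<open>t ^ 4 = 1\<close>, scaling by t leaves the quartics C and D alone,
    while the quadratic B and the sextic \<open>A^3\<close> pick up the sign e.\<close>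
  define t where "t = (if e = 1 then 1 else \<i>)"
  have t: "t\<^sup>2 = e" "t ^ 4 = 1" "t \<noteq> 0" using e(1) by (auto simp: t_def power_numeral_reduce)
  have "e\<^sup>2 = 1" using e(1) by auto
  have "\<exists>w. w ^ 3 = 1 \<and> c1 * c2 = w * ((t * d1) * (t * d2))"
  proof (cases "c1 * c2 = 0")
    case True
    then have "d1 * d2 = 0" using e(1,3) by auto
    then show ?thesis using True by (intro exI[of _ 1]) auto
  next
    case False
    then have "d1 * d2 \<noteq> 0" using e(3) by auto
    have "((t * d1) * (t * d2)) ^ 3 = (t\<^sup>2 * (d1 * d2)) ^ 3" by (simp add: power2_eq_square mult_ac)
    also have "\<dots> = e\<^sup>2 * (e * (d1 * d2) ^ 3)"
      unfolding t by (simp add: power_mult_distrib power2_eq_square power3_eq_cube)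
    also have "\<dots> = (c1 * c2) ^ 3" using \<open>e\<^sup>2 = 1\<close> e(3) by simp
    finally show ?thesis using False \<open>d1 * d2 \<noteq> 0\<close> t(3)
      by (intro exI[of _ "(c1 * c2) / ((t * d1) * (t * d2))"]) (simp add: power_divide)
  qed
  then obtain w where w: "w ^ 3 = 1" "c1 * c2 = w * ((t * d1) * (t * d2))" by blast
  have "c3 * c4 = (t * d3) * (t * d4)" using e(2) by (simp add: mult_ac power2_eq_square flip: t(1))
  moreover have "c1 ^ 3 * c4 = (t * d1) ^ 3 * (t * d4)"
    using C t(2) by (simp add: power_mult_distrib power_numeral_reduce algebra_simps)
  moreover have "c2 ^ 3 * c3 = (t * d2) ^ 3 * (t * d3)"
    using D t(2) by (simp add: power_mult_distrib power_numeral_reduce algebra_simps)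
  ultimately obtain a where "a \<noteq> 0" "c1 = a * (t * d1)" "c2 = w / a * (t * d2)"
      "c3 = a ^ 3 * (t * d3)" "c4 = t * d4 / a ^ 3"
    using torus_orbit_separation[OF w(1) ss w(2)] by blast
  then show ?thesis using w(1) t(3) by blast
qed

definition torus_related :: "complex \<Rightarrow> complex \<Rightarrow> complex \<Rightarrow> complex \<Rightarrow> complex \<Rightarrow> complex \<Rightarrow> complex \<Rightarrow> complex \<Rightarrow> bool" where
  "torus_related c1 c2 c3 c4 d1 d2 d3 d4 \<longleftrightarrow> (\<exists>a w t. a \<noteq> 0 \<and> w ^ 3 = 1 \<and> t \<noteq> 0 \<and>
    c1 = a * (t * d1) \<and> c2 = w / a * (t * d2) \<and> c3 = a ^ 3 * (t * d3) \<and> c4 = t * d4 / a ^ 3)"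

lemma sum_product_determine:
  fixes C D C' D' :: complex
  assumes "C + D = C' + D'" "C * D = C' * D'"
  shows "C = C' \<and> D = D' \<or> C = D' \<and> D = C'"
proof -
  have "D = C' + D' - C" using assms(1) by (simp add: algebra_simps)
  have "(C - C') * (C - D') = C * C - C * (C' + D') + C' * D'" by (simp add: algebra_simps)
  also have "\<dots> = 0" unfolding assms[symmetric] by (simp add: algebra_simps)
  finally show ?thesis using \<open>D = C' + D' - C\<close> by auto
qed

text \<open>\<open>E2\<close> and \<open>E3\<close> determine C and D as an unordered pair. A
  crossed match is a straight match with the exchanged point \<open>d2 d1 d4 d3\<close>.\<close>

lemma E_separate:
  assumes ss: "c1 \<noteq> 0 \<or> c3 \<noteq> 0" "c2 \<noteq> 0 \<or> c4 \<noteq> 0"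
    and e: "E1 c1 c2 c3 c4 = E1 d1 d2 d3 d4" "E2 c1 c2 c3 c4 = E2 d1 d2 d3 d4"
      "E3 c1 c2 c3 c4 = E3 d1 d2 d3 d4" "E4 c1 c2 c3 c4 = E4 d1 d2 d3 d4"
  shows "torus_related c1 c2 c3 c4 d1 d2 d3 d4 \<or> torus_related c1 c2 c3 c4 d2 d1 d4 d3"
  using sum_product_determine[of "c1 ^ 3 * c4" "c2 ^ 3 * c3" "d1 ^ 3 * d4" "d2 ^ 3 * d3"]
    straight_orbit_separation[OF ss, of d3 d4 d1 d2] straight_orbit_separation[OF ss, of d4 d3 d2 d1] e
  unfolding E_defs torus_related_def by (auto simp: mult.commute)

section \<open>Semistability and closed orbits\<close>

lemma scale_cubic: "scale_fun t (cubic c1 c2 c3 c4) = cubic (t * c1) (t * c2) (t * c3) (t * c4)"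
  by (simp add: scale_fun_def cubic_def fun_eq_iff algebra_simps)

lemma scale_fun_V: "F \<in> V_F21 \<Longrightarrow> scale_fun t F \<in> V_F21"
  by (auto simp: V_F21_eq scale_cubic simp del: cubic_in_V) blast

lemma act_scale_fun: "act g (scale_fun t F) = scale_fun t (act g F)"
  by (simp add: act_def scale_fun_def)

lemma act_pt: "act g ` pt scale_fun F = pt scale_fun (act g F)"
  by (auto simp: pt_def act_scale_fun image_iff) (metis act_scale_fun)

lemma scale_scale_fun: "scale_fun t (scale_fun u F) = scale_fun (t * u) F"
  by (simp add: scale_fun_def mult.assoc)

lemma pt_scale_fun: "t \<noteq> 0 \<Longrightarrow> pt scale_fun (scale_fun t F) = pt scale_fun F"
  unfolding pt_def scale_scale_fun
  by (auto simp: mult.assoc[symmetric]) (metis divide_eq_0_iff nonzero_divide_eq_eq)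

lemma in_pt_self: "F \<in> pt scale_fun F"
  unfolding pt_def by (auto simp: scale_fun_def intro!: exI[of _ 1])

lemma cubic_eq_0_iff: "cubic c1 c2 c3 c4 = 0 \<longleftrightarrow> c1 = 0 \<and> c2 = 0 \<and> c3 = 0 \<and> c4 = 0"
proof -
  have "0 = cubic 0 0 0 0" by (simp add: cubic_def fun_eq_iff)
  then show ?thesis using cubic_inject[of c1 c2 c3 c4 0 0 0 0] by metis
qed

lemma cubic_pt_in_proj:
  "cubic_pt c1 c2 c3 c4 \<in> proj scale_fun V_F21 \<longleftrightarrow> \<not> (c1 = 0 \<and> c2 = 0 \<and> c3 = 0 \<and> c4 = 0)"
proof
  assume "cubic_pt c1 c2 c3 c4 \<in> proj scale_fun V_F21"
  then obtain F where F: "F \<noteq> 0" "cubic_pt c1 c2 c3 c4 = pt scale_fun F" unfolding proj_def by auto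
  then obtain t where "F = scale_fun t (cubic c1 c2 c3 c4)" using in_pt_self[of F] by (auto simp: pt_def)
  with F(1) show "\<not> (c1 = 0 \<and> c2 = 0 \<and> c3 = 0 \<and> c4 = 0)"
    using cubic_eq_0_iff by (auto simp: scale_cubic)
next
  assume "\<not> (c1 = 0 \<and> c2 = 0 \<and> c3 = 0 \<and> c4 = 0)"
  then show "cubic_pt c1 c2 c3 c4 \<in> proj scale_fun V_F21"
    unfolding proj_def using cubic_eq_0_iff[of c1 c2 c3 c4] by auto
qed

lemma proj_V_cases:
  assumes "p \<in> proj scale_fun V_F21"
  obtains c1 c2 c3 c4 where "p = cubic_pt c1 c2 c3 c4"
  using assms unfolding proj_def V_F21_eq by blast

text \<open>Coefficients are extracted by evaluating at test vectors. Evaluation is linear on all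
  functions, so these are linear forms on any subspace.\<close>

definition coord :: "nat \<Rightarrow> (complex^6 \<Rightarrow> complex) \<Rightarrow> complex" where
  "coord n F = (if n = 1 then F (vector [1, 1, 0, 0, 0, 0]) else if n = 2 then F (vector [0, 1, 1, 0, 0, 0])
     else if n = 3 then F (vector [1, 0, 1, 0, 1, 0]) else F (vector [0, 1, 0, 1, 0, 1]))"

lemma coord_cubic [simp]:
  "coord 1 (cubic c1 c2 c3 c4) = c1" "coord 2 (cubic c1 c2 c3 c4) = c2"
  "coord 3 (cubic c1 c2 c3 c4) = c3" "coord 4 (cubic c1 c2 c3 c4) = c4"
  by (simp_all add: coord_def cubic_def)

lemma form_coord: "form scale_fun V 1 (coord n)"
  by (rule form.linear) (simp_all add: coord_def scale_fun_def)

definition on_coords :: "(complex \<Rightarrow> complex \<Rightarrow> complex \<Rightarrow> complex \<Rightarrow> complex) \<Rightarrow> (complex^6 \<Rightarrow> complex) \<Rightarrow> complex" where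
  "on_coords E F = E (coord 1 F) (coord 2 F) (coord 3 F) (coord 4 F)"

lemma on_coords_cubic [simp]: "on_coords E (cubic c1 c2 c3 c4) = E c1 c2 c3 c4"
  unfolding on_coords_def coord_cubic ..

lemma form_E:
  "form scale_fun V 4 (on_coords E1)" "form scale_fun V 4 (on_coords E2)"
  "form scale_fun V 8 (on_coords E3)" "form scale_fun V 12 (on_coords E4)"
proof -
  have 34: "form scale_fun V 2 (\<lambda>F. coord 3 F * coord 4 F)" and 12: "form scale_fun V 2 (\<lambda>F. coord 1 F * coord 2 F)"
    using form.mult[OF form_coord[of V 3] form_coord[of V 4]] form.mult[OF form_coord[of V 1] form_coord[of V 2]]
    by (simp_all add: numeral_2_eq_2)
  have C: "form scale_fun V 4 (\<lambda>F. coord 1 F ^ 3 * coord 4 F)" and D: "form scale_fun V 4 (\<lambda>F. coord 2 F ^ 3 * coord 3 F)"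
    using form.mult[OF form_power[OF form_coord[of V 1], of 3] form_coord[of V 4]]
      form.mult[OF form_power[OF form_coord[of V 2], of 3] form_coord[of V 3]] by simp_all
  show "form scale_fun V 4 (on_coords E1)"
    using form_power[OF 34, of 2] by (simp add: on_coords_def[abs_def] E_defs)
  show "form scale_fun V 4 (on_coords E2)"
    using form.add[OF C D] by (simp add: on_coords_def[abs_def] E_defs)
  show "form scale_fun V 8 (on_coords E3)"
    using form.mult[OF C D] by (simp add: on_coords_def[abs_def] E_defs)
  show "form scale_fun V 12 (on_coords E4)"
    using form_power[OF form_power[OF 12, of 3], of 2] by (simp add: on_coords_def[abs_def] E_defs)
qed

text \<open>C and D are multiplied by \<open>\<alpha> ^ 3 * \<delta>\<close> and
  \<open>\<beta> ^ 3 * \<gamma>\<close>, both equal to the square of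
  \<open>\<gamma> * \<delta>\<close>, which is 1. B is multiplied by
  \<open>\<gamma> * \<delta>\<close> and \<open>A^3\<close> by its cube, so their squares are
  invariant, and all four expressions are symmetric under the exchange.\<close>

lemma E_act:
  assumes g: "g \<in> carrier N" and E: "E \<in> {E1, E2, E3, E4}" and F: "F \<in> V_F21"
  shows "on_coords E (act g F) = on_coords E F"
proof -
  obtain c1 c2 c3 c4 where F: "F = cubic c1 c2 c3 c4" using F unfolding V_F21_eq by blast
  obtain \<alpha> \<beta> \<gamma> \<delta> where rel: "\<alpha> ^ 3 = \<gamma>\<^sup>2 * \<delta>" "\<beta> ^ 3 = \<gamma> * \<delta>\<^sup>2" "(\<gamma> * \<delta>)\<^sup>2 = 1"
    and act: "rescales \<alpha> \<beta> \<gamma> \<delta> g \<or> swaps \<alpha> \<beta> \<gamma> \<delta> g"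
    by (rule act_cubic_cases[OF g], rule that, assumption+)
  have \<alpha>\<delta>: "\<alpha> ^ 3 * \<delta> = 1" and \<beta>\<gamma>: "\<beta> ^ 3 * \<gamma> = 1"
    using rel(3) by (simp_all add: rel(1,2) power_mult_distrib power2_eq_square mult_ac)
  have \<alpha>\<beta>: "(\<alpha> ^ 3 * \<beta> ^ 3)\<^sup>2 = 1"
  proof -
    have "\<alpha> ^ 3 * \<beta> ^ 3 = (\<gamma> * \<delta>) ^ 3"
      unfolding rel(1,2) by (simp add: power2_eq_square power3_eq_cube mult_ac)
    then have "(\<alpha> ^ 3 * \<beta> ^ 3)\<^sup>2 = ((\<gamma> * \<delta>)\<^sup>2) ^ 3" by (simp only: power_mult[symmetric] mult.commute)
    then show ?thesis using rel(3) by simp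
  qed
  have "E1 (\<alpha> * c1) (\<beta> * c2) (\<gamma> * c3) (\<delta> * c4) = (\<gamma> * \<delta>)\<^sup>2 * E1 c1 c2 c3 c4"
    "E2 (\<alpha> * c1) (\<beta> * c2) (\<gamma> * c3) (\<delta> * c4) = (\<alpha> ^ 3 * \<delta>) * (c1 ^ 3 * c4) + (\<beta> ^ 3 * \<gamma>) * (c2 ^ 3 * c3)"
    "E3 (\<alpha> * c1) (\<beta> * c2) (\<gamma> * c3) (\<delta> * c4) = (\<alpha> ^ 3 * \<delta>) * (\<beta> ^ 3 * \<gamma>) * E3 c1 c2 c3 c4"
    "E4 (\<alpha> * c1) (\<beta> * c2) (\<gamma> * c3) (\<delta> * c4) = (\<alpha> ^ 3 * \<beta> ^ 3)\<^sup>2 * E4 c1 c2 c3 c4"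
    for c1 c2 c3 c4 by (simp_all add: E_defs power_mult_distrib mult_ac)
  then have scale: "E (\<alpha> * c1) (\<beta> * c2) (\<gamma> * c3) (\<delta> * c4) = E c1 c2 c3 c4" for c1 c2 c3 c4
    using E unfolding \<alpha>\<delta> \<beta>\<gamma> \<alpha>\<beta> rel(3) by (auto simp: E2_def)
  have swap: "E c2 c1 c4 c3 = E c1 c2 c3 c4" using E by (auto simp: E_defs mult_ac add.commute)
  from act show ?thesis
    unfolding rescales_def swaps_def F by (auto simp: scale swap)
qed

lemma invariant_E:
  "invariant_form scale_fun V_F21 N act 4 (on_coords E1)" "invariant_form scale_fun V_F21 N act 4 (on_coords E2)"
  "invariant_form scale_fun V_F21 N act 8 (on_coords E3)" "invariant_form scale_fun V_F21 N act 12 (on_coords E4)"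
  unfolding invariant_form_def using form_E E_act by auto

section \<open>Values of invariants at projective points and their vanishing on the two
  lines\<close>

lemma invariant_form_scale:
  assumes "invariant_form scale_fun V_F21 N act d f" "F \<in> V_F21"
  shows "f (scale_fun t F) = t ^ d * f F"
  using assms form_homogeneous[of scale_fun V_F21 d f] scale_fun_V unfolding invariant_form_def by blast

lemma nonvanishing_iff:
  assumes "invariant_form scale_fun V_F21 N act d f"
  shows "cubic_pt c1 c2 c3 c4 \<in> nonvanishing scale_fun V_F21 f \<longleftrightarrow>
    cubic_pt c1 c2 c3 c4 \<in> proj scale_fun V_F21 \<and> f (cubic c1 c2 c3 c4) \<noteq> 0"
  using in_pt_self[of "cubic c1 c2 c3 c4"] invariant_form_scale[OF assms, of "cubic c1 c2 c3 c4"]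
  by (auto simp: nonvanishing_def pt_def)

text \<open>Supplies the limit for the torus contraction. Only linear forms need an argument: on the
  invariant cubics they are combinations of their values on four basis cubics.\<close>

lemma form_curve_continuous:
  assumes "form scale_fun V_F21 d f"
    and "continuous_on UNIV p1" "continuous_on UNIV p2" "continuous_on UNIV p3" "continuous_on UNIV p4"
  shows "continuous_on (UNIV :: complex set) (\<lambda>b. f (cubic (p1 b) (p2 b) (p3 b) (p4 b)))"
  using assms(1)
proof induction
  case (const a) show ?case by simp
next
  case (linear l)
  have dec: "cubic a1 a2 a3 a4 = scale_fun a1 (cubic 1 0 0 0) + (scale_fun a2 (cubic 0 1 0 0) +
      (scale_fun a3 (cubic 0 0 1 0) + scale_fun a4 (cubic 0 0 0 1)))" for a1 a2 a3 a4
    by (simp add: fun_eq_iff scale_fun_def cubic_def algebra_simps)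
  have add_V: "F + G \<in> V_F21" if FG: "F \<in> V_F21" "G \<in> V_F21" for F G
  proof -
    obtain c1 c2 c3 c4 d1 d2 d3 d4 where "F = cubic c1 c2 c3 c4" "G = cubic d1 d2 d3 d4"
      using FG unfolding V_F21_eq by blast
    then have "F + G = cubic (c1 + d1) (c2 + d2) (c3 + d3) (c4 + d4)"
      by (simp add: fun_eq_iff cubic_def algebra_simps)
    then show ?thesis by simp
  qed
  have "l (cubic a1 a2 a3 a4) = a1 * l (cubic 1 0 0 0) + (a2 * l (cubic 0 1 0 0) +
      (a3 * l (cubic 0 0 1 0) + a4 * l (cubic 0 0 0 1)))" for a1 a2 a3 a4
    by (rule trans[OF arg_cong[OF dec]]) (simp only: linear add_V scale_fun_V cubic_in_V)
  then obtain k1 k2 k3 k4 where "\<And>a1 a2 a3 a4. l (cubic a1 a2 a3 a4) = a1 * k1 + (a2 * k2 + (a3 * k3 + a4 * k4))"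
    by blast
  then show ?case by (simp only:) (intro continuous_intros assms)
next
  case (add d f g) then show ?case by (intro continuous_intros)
next
  case (mult d f e g) then show ?case by (intro continuous_intros)
qed

text \<open>The torus contracts these points to the origin.\<close>

lemma invariant_vanishes:
  assumes f: "invariant_form scale_fun V_F21 N act d f" and "d > 0"
    and c: "c1 = 0 \<and> c3 = 0 \<or> c2 = 0 \<and> c4 = 0"
  shows "f (cubic c1 c2 c3 c4) = 0"
proof -
  \<comment> \<open>The exponents 1, 1, 3, 3 are the absolute torus weights, so one curve serves
    both lines: for b nonzero it is traced by the torus with parameter 1/b on the first line and b
    on the second. G is thus constant off 0, and continuity at 0 gives the value at the zero
    form.\<close>
  define G where "G b = f (cubic (b * c1) (b * c2) (b ^ 3 * c3) (b ^ 3 * c4))" for b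
  have form: "form scale_fun V_F21 d f" using f by (simp add: invariant_form_def)
  have "continuous_on UNIV G" unfolding G_def
    by (intro form_curve_continuous[OF form] continuous_intros)
  then have lim: "(G \<longlongrightarrow> G 0) (at 0)"
    by (simp add: continuous_on_eq_continuous_at isCont_def)
  have "G b = G 1" if "b \<noteq> 0" for b
  proof -
    have inv: "f (act (torus_elt a 1) F) = f F" if "a \<noteq> 0" "F \<in> V_F21" for a F
      using f torus_elt_in_N[OF that(1), of 1] that unfolding invariant_form_def by auto
    from c show ?thesis
    proof
      assume "c1 = 0 \<and> c3 = 0"
      then show ?thesis
        using inv[of "1 / b" "cubic 0 (b * c2) 0 (b ^ 3 * c4)"] act_torus_elt[of "1 / b" 1 0 c2 0 c4] that
        by (simp add: G_def power_divide mult.commute)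
    next
      assume "c2 = 0 \<and> c4 = 0"
      then show ?thesis
        using inv[of b "cubic (b * c1) 0 (b ^ 3 * c3) 0"] act_torus_elt[of b 1 c1 0 c3 0] that
        by (simp add: G_def)
    qed
  qed
  then have "\<forall>\<^sub>F b in at 0. G b = G 1"
    unfolding eventually_at_filter by (intro always_eventually) blast
  then have "(G \<longlongrightarrow> G 1) (at 0)" by (rule tendsto_eventually)
  then have "G 1 = G 0" using lim by (rule tendsto_unique[rotated]) simp
  also have "G 0 = f (scale_fun 0 (cubic c1 c2 c3 c4))" by (simp add: G_def scale_cubic)
  also have "\<dots> = 0" using invariant_form_scale[OF f] \<open>d > 0\<close> by simp
  finally show ?thesis by (simp add: G_def)
qed

definition stable_coords :: "complex \<Rightarrow> complex \<Rightarrow> complex \<Rightarrow> complex \<Rightarrow> bool" where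
  "stable_coords c1 c2 c3 c4 \<longleftrightarrow> (c1 \<noteq> 0 \<or> c3 \<noteq> 0) \<and> (c2 \<noteq> 0 \<or> c4 \<noteq> 0)"

lemma semistable_imp:
  assumes "N_semistable (cubic_pt c1 c2 c3 c4)" shows "stable_coords c1 c2 c3 c4"
proof -
  obtain d f where "d > 0" and f: "invariant_form scale_fun V_F21 N act d f"
    and "cubic_pt c1 c2 c3 c4 \<in> nonvanishing scale_fun V_F21 f"
    using assms unfolding semistable_def by blast
  then have "f (cubic c1 c2 c3 c4) \<noteq> 0" using nonvanishing_iff[OF f] by simp
  then show ?thesis using invariant_vanishes[OF f \<open>d > 0\<close>] unfolding stable_coords_def by blast
qed

lemma stable_imp_semistable: "N_stable p \<Longrightarrow> N_semistable p"
  unfolding stable_def semistable_def by blast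

text \<open>If \<open>c1 * c2\<close> or \<open>c3 * c4\<close> is nonzero, \<open>E4\<close> or
  \<open>E1\<close> is. Otherwise exactly one of C, D is nonzero and their sum \<open>E2\<close>
  cannot cancel.\<close>

lemma stable_coords_E:
  assumes "stable_coords c1 c2 c3 c4"
  shows "\<not> (E1 c1 c2 c3 c4 = 0 \<and> E2 c1 c2 c3 c4 = 0 \<and> E4 c1 c2 c3 c4 = 0)"
  using assms unfolding stable_coords_def E_defs by auto

lemma stable_coords_imp_semistable:
  assumes "stable_coords c1 c2 c3 c4" shows "N_semistable (cubic_pt c1 c2 c3 c4)"
proof -
  have proj: "cubic_pt c1 c2 c3 c4 \<in> proj scale_fun V_F21"
    using assms by (auto simp: cubic_pt_in_proj stable_coords_def)
  from stable_coords_E[OF assms] obtain d E where "d > (0::nat)"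
    "invariant_form scale_fun V_F21 N act d (on_coords E)" "E c1 c2 c3 c4 \<noteq> 0"
    using invariant_E by (metis zero_less_numeral)
  then show ?thesis unfolding semistable_def using nonvanishing_iff proj by (metis on_coords_cubic)
qed

section \<open>Orbits of points off the two lines, and their closedness\<close>

lemma act_comp:
  assumes "det g = 1" "det h = 1" shows "act (g ** h) F = act g (act h F)"
proof -
  have "(matrix_inv h ** matrix_inv g) ** (g ** h) = matrix_inv h ** (matrix_inv g ** g) ** h"
    by (simp add: matrix_mul_assoc)
  also have "\<dots> = mat 1" using det_1_inv[OF assms(1)] det_1_inv[OF assms(2)] by simp
  finally have "matrix_inv (g ** h) = matrix_inv h ** matrix_inv g" by (rule matrix_inv_unique)
  then show ?thesis by (simp add: act_def matrix_vector_mul_assoc)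
qed

lemma N_mult:
  assumes "g \<in> carrier N" "h \<in> carrier N" shows "g ** h \<in> carrier N"
proof -
  have "subgroup (normalizer SL6 G2) SL6"
    using G2_det by (intro group.normalizer_imp_subgroup group_SL6) (auto simp: carrier_SL6)
  from subgroup.m_closed[OF this, of g h] assms show ?thesis by (simp add: N_def SL6_def)
qed

lemma torus_related_orbit:
  assumes "torus_related c1 c2 c3 c4 d1 d2 d3 d4"
  shows "\<exists>g\<in>carrier N. act g ` cubic_pt c1 c2 c3 c4 = cubic_pt d1 d2 d3 d4"
proof -
  obtain a w t where a: "a \<noteq> 0" and w: "w ^ 3 = 1" and t: "t \<noteq> 0"
    and c: "c1 = a * (t * d1)" "c2 = w / a * (t * d2)" "c3 = a ^ 3 * (t * d3)" "c4 = t * d4 / a ^ 3"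
    using assms unfolding torus_related_def by blast
  have "act (torus_elt a w) (cubic c1 c2 c3 c4) = scale_fun t (cubic d1 d2 d3 d4)"
    unfolding c act_torus_elt[OF a w] scale_cubic ..
  then show ?thesis using torus_elt_in_N[OF a w] pt_scale_fun[OF t] by (metis act_pt)
qed

lemma swap_orbit:
  assumes "g \<in> carrier N" "act g ` p = cubic_pt d2 d1 d4 d3"
  shows "\<exists>g\<in>carrier N. act g ` p = cubic_pt d1 d2 d3 d4"
proof -
  obtain h k where h: "h \<in> carrier N" "k \<noteq> 0"
    "\<And>c1 c2 c3 c4. act h (cubic (k * c2) (k * c1) (k * c4) (k * c3)) = cubic c1 c2 c3 c4"
    using ex_swap by blast
  have "act (h ** g) ` p = act h ` act g ` p"
    using act_comp[OF N_det[OF h(1)] N_det[OF assms(1)]] by (simp add: image_image)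
  also have "\<dots> = pt scale_fun (act h (cubic d2 d1 d4 d3))" by (simp add: assms(2) act_pt)
  also have "\<dots> = pt scale_fun (scale_fun k (act h (cubic d2 d1 d4 d3)))" using h(2) by (simp add: pt_scale_fun)
  also have "\<dots> = cubic_pt d1 d2 d3 d4" by (simp add: h(3) scale_cubic flip: act_scale_fun)
  finally show ?thesis using N_mult[OF h(1) assms(1)] by blast
qed

text \<open>The hypothesis says that the two points have proportional values in every degree. A
  rescaling of d makes the four values equal, \<open>E_separate\<close> gives a torus element, and a
  possible exchange is undone by \<open>swap_orbit\<close>.\<close>

lemma same_invariants_same_orbit:
  assumes c: "stable_coords c1 c2 c3 c4" and d: "stable_coords d1 d2 d3 d4"
    and inv: "\<And>n f h. invariant_form scale_fun V_F21 N act n f \<Longrightarrow> invariant_form scale_fun V_F21 N act n h \<Longrightarrow>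
      f (cubic d1 d2 d3 d4) * h (cubic c1 c2 c3 c4) = f (cubic c1 c2 c3 c4) * h (cubic d1 d2 d3 d4)"
  shows "\<exists>g\<in>carrier N. act g ` cubic_pt c1 c2 c3 c4 = cubic_pt d1 d2 d3 d4"
proof -
  have power_inv: "invariant_form scale_fun V_F21 N act (m * n) (\<lambda>F. f F ^ m)"
    if "invariant_form scale_fun V_F21 N act n f" for m n f
    using that form_power unfolding invariant_form_def by auto
  \<comment> \<open>Squares and cubes bring \<open>E1\<close> and \<open>E2\<close> to degrees 8 and
    12, where they are comparable with \<open>E3\<close> and \<open>E4\<close>.\<close>
  have pow: "invariant_form scale_fun V_F21 N act 8 (\<lambda>F. on_coords E1 F ^ 2)" "invariant_form scale_fun V_F21 N act 8 (\<lambda>F. on_coords E2 F ^ 2)"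
     "invariant_form scale_fun V_F21 N act 12 (\<lambda>F. on_coords E1 F ^ 3)" "invariant_form scale_fun V_F21 N act 12 (\<lambda>F. on_coords E2 F ^ 3)"
    using power_inv[OF invariant_E(1), of 2] power_inv[OF invariant_E(2), of 2]
      power_inv[OF invariant_E(1), of 3] power_inv[OF invariant_E(2), of 3] by simp_all
  obtain s where s: "s \<noteq> 0" "E1 d1 d2 d3 d4 = s * E1 c1 c2 c3 c4" "E2 d1 d2 d3 d4 = s * E2 c1 c2 c3 c4"
    "E3 d1 d2 d3 d4 = s\<^sup>2 * E3 c1 c2 c3 c4" "E4 d1 d2 d3 d4 = s ^ 3 * E4 c1 c2 c3 c4"
    using weighted_proportional[OF E_syzygy stable_coords_E[OF c] E_syzygy stable_coords_E[OF d]]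
      inv[OF invariant_E(1,2)] inv[OF pow(1) invariant_E(3)] inv[OF pow(2) invariant_E(3)]
      inv[OF pow(3) invariant_E(4)] inv[OF pow(4) invariant_E(4)] by auto
  \<comment> \<open>Scaling coordinates by t acts on the values only through \<open>t ^ 4\<close>,
    so a fourth root of s is the scalar to divide by.\<close>
  obtain t where t: "s = t ^ 4" by (rule exists_complex_root[of 4 s]) simp_all
  then have "t \<noteq> 0" using s(1) by auto
  define u where "u = 1 / t"
  have u: "u \<noteq> 0" "u ^ 4 * s = 1" using \<open>t \<noteq> 0\<close> by (simp_all add: u_def t power_divide)
  then have u': "(u ^ 4)\<^sup>2 * s\<^sup>2 = 1" "(u ^ 4) ^ 3 * s ^ 3 = 1" by (simp_all only: power_mult_distrib[symmetric] power_one)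
  have eq: "E1 (u * d1) (u * d2) (u * d3) (u * d4) = E1 c1 c2 c3 c4" "E2 (u * d1) (u * d2) (u * d3) (u * d4) = E2 c1 c2 c3 c4"
    "E3 (u * d1) (u * d2) (u * d3) (u * d4) = E3 c1 c2 c3 c4" "E4 (u * d1) (u * d2) (u * d3) (u * d4) = E4 c1 c2 c3 c4"
    unfolding E_scale s(2-5) mult.assoc[symmetric] u u' by simp_all
  have "torus_related c1 c2 c3 c4 (u * d1) (u * d2) (u * d3) (u * d4)
      \<or> torus_related c1 c2 c3 c4 (u * d2) (u * d1) (u * d4) (u * d3)"
    using c unfolding stable_coords_def by (intro E_separate) (simp_all add: eq)
  then have "\<exists>g\<in>carrier N. act g ` cubic_pt c1 c2 c3 c4 = cubic_pt (u * d1) (u * d2) (u * d3) (u * d4)"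
    using torus_related_orbit swap_orbit by meson
  then show ?thesis using pt_scale_fun[OF u(1)] by (simp flip: scale_cubic)
qed

text \<open>Works for every invariant of positive degree: its nonvanishing locus lies off the two
  lines, where proportional values of invariants imply equal orbits. Hence the form that witnesses
  semistability also witnesses stability.\<close>

lemma orbit_closed:
  assumes f: "invariant_form scale_fun V_F21 N act d f" "d > 0"
    and q: "q \<in> nonvanishing scale_fun V_F21 f"
  shows "\<exists>Z. zariski_closed scale_fun V_F21 Z \<and>
    orbit N (\<lambda>g. (`) (act g)) q = Z \<inter> nonvanishing scale_fun V_F21 f"
proof -
  have "q \<in> proj scale_fun V_F21" using q by (simp add: nonvanishing_def)
  then obtain c1 c2 c3 c4 where q_eq: "q = cubic_pt c1 c2 c3 c4" by (rule proj_V_cases)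
  let ?u = "cubic c1 c2 c3 c4"
  have stable_coords: "stable_coords d1 d2 d3 d4" if "cubic_pt d1 d2 d3 d4 \<in> nonvanishing scale_fun V_F21 f" for d1 d2 d3 d4
    using f that by (intro semistable_imp) (auto simp: semistable_def)
  \<comment> \<open>The equations say that the values at F and at the base point are proportional.
    Equal degrees of i and j keep each equation homogeneous, hence meaningful on projective
    points.\<close>
  define H where "H = {\<lambda>F. i F * j ?u - i ?u * j F | i j. \<exists>n. invariant_form scale_fun V_F21 N act n i \<and>
      invariant_form scale_fun V_F21 N act n j}"
  define Z where "Z = {p \<in> proj scale_fun V_F21. \<forall>h\<in>H. \<forall>v\<in>p. h v = 0}"
  have "\<exists>d. form scale_fun V_F21 d h" if "h \<in> H" for h
  proof -
    obtain i j n where ij: "h = (\<lambda>F. i F * j ?u - i ?u * j F)" "form scale_fun V_F21 n i" "form scale_fun V_F21 n j"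
      using \<open>h \<in> H\<close> unfolding H_def invariant_form_def by blast
    have "form scale_fun V_F21 n h"
      unfolding ij(1) mult.commute[of _ "j ?u"] by (intro form_diff form_const_mult ij(2,3))
    then show ?thesis by blast
  qed
  then have "zariski_closed scale_fun V_F21 Z"
    unfolding zariski_closed_def Z_def by blast
  moreover have "orbit N (\<lambda>g. (`) (act g)) q = Z \<inter> nonvanishing scale_fun V_F21 f"
  proof (intro equalityI subsetI)
    fix p assume "p \<in> orbit N (\<lambda>g. (`) (act g)) q"
    then obtain g where g: "g \<in> carrier N" "p = pt scale_fun (act g ?u)"
      unfolding orbit_def q_eq act_pt by blast
    have V: "act g ?u \<in> V_F21" using act_V_F21[OF g(1)] by simp
    then obtain d1 d2 d3 d4 where d: "act g ?u = cubic d1 d2 d3 d4" unfolding V_F21_eq by blast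
    have inv: "i (act g ?u) = i ?u" if "invariant_form scale_fun V_F21 N act n i" for n i
      using that g(1) unfolding invariant_form_def by simp
    have "f ?u \<noteq> 0" using q nonvanishing_iff[OF f(1)] by (simp add: q_eq)
    have "act g ?u \<noteq> 0"
    proof
      assume "act g ?u = 0"
      then have "act g ?u = scale_fun 0 ?u" by (simp add: scale_fun_def fun_eq_iff)
      then have "f ?u = f (scale_fun 0 ?u)" using inv[OF f(1)] by simp
      then show False using invariant_form_scale[OF f(1), of ?u 0] \<open>f ?u \<noteq> 0\<close> \<open>d > 0\<close>
        by (auto simp: power_0_left)
    qed
    then have proj: "p \<in> proj scale_fun V_F21" using V g(2) unfolding proj_def by auto
    then have "p \<in> nonvanishing scale_fun V_F21 f"
      using nonvanishing_iff[OF f(1), of d1 d2 d3 d4] inv[OF f(1)] \<open>f ?u \<noteq> 0\<close> by (simp add: g(2) d)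
    moreover have "h v = 0" if "h \<in> H" "v \<in> p" for h v
    proof -
      obtain i j n where ij: "h = (\<lambda>F. i F * j ?u - i ?u * j F)"
        "invariant_form scale_fun V_F21 N act n i" "invariant_form scale_fun V_F21 N act n j"
        using \<open>h \<in> H\<close> unfolding H_def by blast
      obtain t where "v = scale_fun t (act g ?u)" using \<open>v \<in> p\<close> unfolding g(2) pt_def by blast
      then show ?thesis
        using invariant_form_scale[OF ij(2) V] invariant_form_scale[OF ij(3) V] inv[OF ij(2)] inv[OF ij(3)]
        by (simp add: ij(1))
    qed
    ultimately show "p \<in> Z \<inter> nonvanishing scale_fun V_F21 f" using proj unfolding Z_def by blast
  next
    fix p assume p: "p \<in> Z \<inter> nonvanishing scale_fun V_F21 f"
    then have "p \<in> proj scale_fun V_F21" by (simp add: Z_def)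
    then obtain d1 d2 d3 d4 where d: "p = cubic_pt d1 d2 d3 d4" by (rule proj_V_cases)
    have "i (cubic d1 d2 d3 d4) * j ?u = i ?u * j (cubic d1 d2 d3 d4)"
      if "invariant_form scale_fun V_F21 N act n i" "invariant_form scale_fun V_F21 N act n j" for n i j
    proof -
      have "(\<lambda>F. i F * j ?u - i ?u * j F) \<in> H" using that unfolding H_def by blast
      then show ?thesis using p in_pt_self[of "cubic d1 d2 d3 d4"] unfolding Z_def d by force
    qed
    then have "\<exists>g\<in>carrier N. act g ` q = p"
      unfolding q_eq d using p q by (intro same_invariants_same_orbit stable_coords) (auto simp: q_eq d)
    then show "p \<in> orbit N (\<lambda>g. (`) (act g)) q" unfolding orbit_def by blast
  qed
  ultimately show ?thesis by blast
qed

section \<open>Finite stabilizers\<close>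

lemma finite_matrices:
  assumes "finite L" shows "finite {M :: complex^6^6. \<forall>r k. M $ r $ k \<in> L}"
proof -
  have vec: "finite {v :: 'b^6. \<forall>k. v $ k \<in> S}" if "finite S" for S :: "'b set"
  proof (rule finite_subset)
    show "{v :: 'b^6. \<forall>k. v $ k \<in> S} \<subseteq> vec_lambda ` (PiE UNIV (\<lambda>_. S))"
    proof
      fix v :: "'b^6" assume "v \<in> {v. \<forall>k. v $ k \<in> S}"
      then have "($) v \<in> PiE UNIV (\<lambda>_. S)" by auto
      then have "vec_lambda (($) v) \<in> vec_lambda ` (PiE UNIV (\<lambda>_. S))" by (rule imageI)
      then show "v \<in> vec_lambda ` (PiE UNIV (\<lambda>_. S))" by simp
    qed
  qed (intro finite_imageI finite_PiE that finite_class.finite_UNIV)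
  show ?thesis using vec[OF vec[OF assms]] by simp
qed

text \<open>Three rounds of \<open>x \<mapsto> k * x ^ 4\<close> give
  \<open>x = k ^ 21 * x ^ 64\<close>, with 21 = 1 + 4 + 16.\<close>

lemma cycle_of_quartics:
  fixes x y z k :: complex
  assumes "x \<noteq> 0" "k \<noteq> 0" "y = k * x ^ 4" "z = k * y ^ 4" "x = k * z ^ 4"
  shows "x ^ 63 = 1 / k ^ 21"
proof -
  have "x = k * (k * (k * x ^ 4) ^ 4) ^ 4" using assms(3-5) by simp
  also have "\<dots> = k ^ 21 * x ^ 64"
    by (simp only: power_mult_distrib power_mult[symmetric]) (simp flip: mult.assoc power_Suc power_add)
  also have "\<dots> = x * (k ^ 21 * x ^ 63)" by (simp add: power_numeral_reduce)
  finally have "k ^ 21 * x ^ 63 = 1" using assms(1) by simp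
  then show ?thesis using assms(2) by (simp add: field_simps)
qed

lemma square_mult_chain:
  fixes a b x y z :: complex
  assumes "x\<^sup>2 * y = a" "y\<^sup>2 * z = b" "x \<noteq> 0" "y \<noteq> 0"
  shows "z = b / a\<^sup>2 * x ^ 4"
  using assms(3,4) by (simp add: assms(1,2)[symmetric] field_simps power_numeral_reduce)

text \<open>Off the two lines there are two nonzero coordinates whose torus weights have opposite
  sign. Fixing the projective point equates their factors, and the relations then make \<alpha> or
  \<beta> a twelfth root of unity; \<open>\<alpha> ^ 12 * \<beta> ^ 12 = 1\<close> transfers this to
  the other. The exponent 36 is shared with the swapping case.\<close>

lemma rescaling_factor_roots:
  fixes \<alpha> \<beta> \<gamma> \<delta> t :: complex
  assumes rel: "\<alpha> ^ 3 = \<gamma>\<^sup>2 * \<delta>" "\<beta> ^ 3 = \<gamma> * \<delta>\<^sup>2" "(\<gamma> * \<delta>)\<^sup>2 = 1"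
    and c: "stable_coords c1 c2 c3 c4"
    and eq: "\<alpha> * c1 = t * c1" "\<beta> * c2 = t * c2" "\<gamma> * c3 = t * c3" "\<delta> * c4 = t * c4"
  shows "\<alpha> ^ 36 = 1 \<and> \<beta> ^ 36 = 1"
proof -
  have 36: "x ^ 36 = (x ^ 12) ^ 3" for x :: complex by (simp flip: power_mult)
  have prod12: "\<alpha> ^ 12 * \<beta> ^ 12 = 1"
  proof -
    have "\<alpha> ^ 12 * \<beta> ^ 12 = (\<alpha> ^ 3 * \<beta> ^ 3) ^ 4" by (simp add: power_mult_distrib flip: power_mult)
    also have "\<alpha> ^ 3 * \<beta> ^ 3 = (\<gamma> * \<delta>) ^ 3"
      unfolding rel by (simp add: power2_eq_square power3_eq_cube mult_ac)
    also have "((\<gamma> * \<delta>) ^ 3) ^ 4 = ((\<gamma> * \<delta>)\<^sup>2) ^ 6" by (simp flip: power_mult)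
    finally show ?thesis using rel(3) by simp
  qed
  have \<alpha>\<delta>: "\<alpha> ^ 3 * \<delta> = 1" and \<beta>\<gamma>: "\<beta> ^ 3 * \<gamma> = 1"
    using rel(3) by (simp_all add: rel(1,2) power_mult_distrib power2_eq_square mult_ac)
  have twelve: "x ^ 12 = (x ^ 4) ^ 3" for x :: complex by (simp flip: power_mult)
  from c consider "c1 \<noteq> 0" "c2 \<noteq> 0" | "c1 \<noteq> 0" "c4 \<noteq> 0" | "c3 \<noteq> 0" "c2 \<noteq> 0" | "c3 \<noteq> 0" "c4 \<noteq> 0"
    unfolding stable_coords_def by blast
  then have "\<alpha> ^ 36 = 1 \<or> \<beta> ^ 36 = 1"
  proof cases
    case 1
    then have "\<alpha> = \<beta>" using eq by simp
    have "\<alpha> ^ 6 = \<alpha> ^ 3 * \<beta> ^ 3" using \<open>\<alpha> = \<beta>\<close> by (simp flip: power_add)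
    also have "\<dots> = (\<gamma> * \<delta>) ^ 3"
      unfolding rel by (simp add: power2_eq_square power3_eq_cube mult_ac)
    finally have "\<alpha> ^ 6 = (\<gamma> * \<delta>) ^ 3" .
    then have "(\<alpha> ^ 6)\<^sup>2 = ((\<gamma> * \<delta>)\<^sup>2) ^ 3" by (simp only: power_mult[symmetric] mult.commute)
    then have "\<alpha> ^ 12 = 1" using rel(3) by (simp flip: power_mult)
    then show ?thesis unfolding 36 by simp
  next
    case 2
    then have "\<alpha> = \<delta>" using eq by simp
    then have "\<alpha> ^ 4 = 1" using \<alpha>\<delta> by (simp add: power_numeral_reduce mult_ac)
    then have "\<alpha> ^ 12 = 1" unfolding twelve by simp
    then show ?thesis unfolding 36 by simp
  next
    case 3
    then have "\<beta> = \<gamma>" using eq by simp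
    then have "\<beta> ^ 4 = 1" using \<beta>\<gamma> by (simp add: power_numeral_reduce mult_ac)
    then have "\<beta> ^ 12 = 1" unfolding twelve by simp
    then show ?thesis unfolding 36 by simp
  next
    case 4
    then have "\<gamma> = \<delta>" using eq by simp
    then have "\<delta> ^ 4 = 1" using rel(3) by (simp add: power_numeral_reduce mult_ac)
    have "\<alpha> ^ 12 = (\<alpha> ^ 3) ^ 4" by (simp flip: power_mult)
    also have "\<alpha> ^ 3 = \<delta> ^ 3"
      unfolding rel \<open>\<gamma> = \<delta>\<close> by (simp add: power2_eq_square power3_eq_cube)
    also have "(\<delta> ^ 3) ^ 4 = (\<delta> ^ 4) ^ 3" by (simp flip: power_mult)
    finally have "\<alpha> ^ 12 = 1" using \<open>\<delta> ^ 4 = 1\<close> by simp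
    then show ?thesis unfolding 36 by simp
  qed
  moreover have "\<alpha> ^ 36 * \<beta> ^ 36 = (\<alpha> ^ 12 * \<beta> ^ 12) ^ 3"
    unfolding 36 by (simp only: power_mult_distrib)
  ultimately show ?thesis using prod12 by auto
qed

text \<open>Here the factors are t times ratios of coordinates. The product of the two factors of an
  exchanged pair is the square of t, and the relations turn this into \<open>t ^ 12 = 1\<close> or
  \<open>t ^ 4 = 1\<close>. With \<open>c1 = c2 = 0\<close> only the cubes of \<alpha> and \<beta>
  are expressed by ratios, hence the exponent 12 there.\<close>

lemma swapping_factor_roots:
  fixes \<alpha> \<beta> \<gamma> \<delta> t :: complex
  assumes rel: "\<alpha> ^ 3 = \<gamma>\<^sup>2 * \<delta>" "\<beta> ^ 3 = \<gamma> * \<delta>\<^sup>2" "(\<gamma> * \<delta>)\<^sup>2 = 1" and t: "t \<noteq> 0"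
    and c: "stable_coords c1 c2 c3 c4"
    and eq: "\<alpha> * c2 = t * c1" "\<beta> * c1 = t * c2" "\<gamma> * c4 = t * c3" "\<delta> * c3 = t * c4"
  shows "{\<alpha> ^ 36, \<beta> ^ 36} \<subseteq> {(c1 / c2) ^ 36, (c2 / c1) ^ 36, (c3 / c4) ^ 12, (c4 / c3) ^ 12}"
proof (cases "c1 = 0")
  case False
  then have "c2 \<noteq> 0" using eq(1) t by auto
  then have ab: "\<alpha> = t * (c1 / c2)" "\<beta> = t * (c2 / c1)" using False eq by (simp_all add: field_simps)
  then have "\<alpha> * \<beta> = t\<^sup>2" using False \<open>c2 \<noteq> 0\<close> by (simp add: power2_eq_square)
  have "t ^ 12 = (\<alpha> ^ 3 * \<beta> ^ 3)\<^sup>2"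
    by (simp add: \<open>\<alpha> * \<beta> = t\<^sup>2\<close> flip: power_mult power_mult_distrib)
  also have "\<alpha> ^ 3 * \<beta> ^ 3 = (\<gamma> * \<delta>) ^ 3"
      unfolding rel by (simp add: power2_eq_square power3_eq_cube mult_ac)
  also have "((\<gamma> * \<delta>) ^ 3)\<^sup>2 = ((\<gamma> * \<delta>)\<^sup>2) ^ 3" by (simp only: power_mult[symmetric] mult.commute)
  finally have "t ^ 12 = 1" using rel(3) by simp
  have "t ^ 36 = (t ^ 12) ^ 3" by (simp flip: power_mult)
  then have "t ^ 36 = 1" using \<open>t ^ 12 = 1\<close> by simp
  then have "\<alpha> ^ 36 = (c1 / c2) ^ 36" "\<beta> ^ 36 = (c2 / c1) ^ 36" unfolding ab power_mult_distrib by simp_all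
  then show ?thesis by blast
next
  case True
  then have "c2 = 0" using eq(2) t by auto
  with True c have c34: "c3 \<noteq> 0" "c4 \<noteq> 0" by (auto simp: stable_coords_def)
  then have gd: "\<gamma> = t * (c3 / c4)" "\<delta> = t * (c4 / c3)" using eq by (simp_all add: field_simps)
  then have "\<gamma> * \<delta> = t\<^sup>2" using c34 by (simp add: power2_eq_square)
  then have "t ^ 4 = 1" using rel(3) by (simp flip: power_mult)
  have "t ^ 36 = (t ^ 4) ^ 9" by (simp flip: power_mult)
  then have "t ^ 36 = 1" using \<open>t ^ 4 = 1\<close> by simp
  have 36: "x ^ 36 = (x ^ 3) ^ 12" for x :: complex by (simp flip: power_mult)
  have "\<alpha> ^ 3 = \<gamma> * (\<gamma> * \<delta>)" "\<beta> ^ 3 = \<delta> * (\<gamma> * \<delta>)"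
    unfolding rel by (simp_all add: power2_eq_square mult_ac)
  then have "\<alpha> ^ 3 = t ^ 3 * (c3 / c4)" "\<beta> ^ 3 = t ^ 3 * (c4 / c3)"
    unfolding \<open>\<gamma> * \<delta> = t\<^sup>2\<close> gd by (simp_all add: power2_eq_square power3_eq_cube mult_ac)
  then have "\<alpha> ^ 36 = t ^ 36 * (c3 / c4) ^ 12" "\<beta> ^ 36 = t ^ 36 * (c4 / c3) ^ 12"
    unfolding 36[of \<alpha>] 36[of \<beta>] 36[of t] by (simp_all only: power_mult_distrib)
  then show ?thesis using \<open>t ^ 36 = 1\<close> by auto
qed

text \<open>Eliminating the entry between two of equal parity gives
  \<open>l (k + 2) = \<kappa> * l k ^ 4\<close>, where \<kappa> depends only on \<alpha>, \<beta>
  and the parity. One turn around the three indices of a parity class fixes each 63rd power, and g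
  is recovered from its inverse.\<close>

lemma finite_stabilizer:
  assumes c: "stable_coords c1 c2 c3 c4"
  shows "finite (stabilizer N (\<lambda>g. (`) (act g)) (cubic_pt c1 c2 c3 c4))"
proof -
  \<comment> \<open>A ratio with zero denominator is 0 and contributes only the root 0, so X is
    finite in every case. In \<open>L\<close> the two parameters range independently over X,
    covering both parities, where \<alpha> and \<beta> trade places.\<close>
  define X where "X = (\<Union>y \<in> {1, (c1 / c2) ^ 36, (c2 / c1) ^ 36, (c3 / c4) ^ 12, (c4 / c3) ^ 12}. {x::complex. x ^ 36 = y})"
  define L where "L = (\<Union>a\<in>X. \<Union>b\<in>X. {x::complex. x ^ 63 = 1 / (b / a\<^sup>2) ^ 21})"
  have "finite X" unfolding X_def by (intro finite_UN_I finite_nth_roots) auto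
  then have "finite L" unfolding L_def by (intro finite_UN_I finite_nth_roots) auto
  have "g \<in> matrix_inv ` {M. \<forall>r k. M $ r $ k \<in> insert 0 L}"
    if "g \<in> stabilizer N (\<lambda>g. (`) (act g)) (cubic_pt c1 c2 c3 c4)" for g
  proof -
    have g: "g \<in> carrier N" and "act g ` cubic_pt c1 c2 c3 c4 = cubic_pt c1 c2 c3 c4"
      using that by (auto simp: stabilizer_def)
    then have "act g (cubic c1 c2 c3 c4) \<in> cubic_pt c1 c2 c3 c4"
      using in_pt_self[of "act g (cubic c1 c2 c3 c4)"] by (simp add: act_pt)
    then obtain t where t: "t \<noteq> 0" "act g (cubic c1 c2 c3 c4) = cubic (t * c1) (t * c2) (t * c3) (t * c4)"
      unfolding pt_def scale_cubic by blast
    show ?thesis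
    proof (rule act_cubic_cases[OF g])
      fix l m \<alpha> \<beta> \<gamma> \<delta>
      assume h: "\<And>r k. matrix_inv g $ r $ k = (if r = k + m then l k else 0)"
        and l: "\<And>k. l k \<noteq> 0"
        and \<alpha>: "(l 1)\<^sup>2 * l 2 = \<alpha>" "(l 3)\<^sup>2 * l 4 = \<alpha>" "(l 5)\<^sup>2 * l 6 = \<alpha>"
        and \<beta>: "(l 2)\<^sup>2 * l 3 = \<beta>" "(l 4)\<^sup>2 * l 5 = \<beta>" "(l 6)\<^sup>2 * l 1 = \<beta>"
        and rel: "\<alpha> ^ 3 = \<gamma>\<^sup>2 * \<delta>" "\<beta> ^ 3 = \<gamma> * \<delta>\<^sup>2" "(\<gamma> * \<delta>)\<^sup>2 = 1"
        and act: "rescales \<alpha> \<beta> \<gamma> \<delta> g \<or> swaps \<alpha> \<beta> \<gamma> \<delta> g"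
      have X: "\<alpha> \<in> X" "\<beta> \<in> X"
      proof -
        have "{\<alpha> ^ 36, \<beta> ^ 36} \<subseteq> {1, (c1 / c2) ^ 36, (c2 / c1) ^ 36, (c3 / c4) ^ 12, (c4 / c3) ^ 12}"
          using act
        proof
          assume "rescales \<alpha> \<beta> \<gamma> \<delta> g"
          then have "\<alpha> * c1 = t * c1 \<and> \<beta> * c2 = t * c2 \<and> \<gamma> * c3 = t * c3 \<and> \<delta> * c4 = t * c4"
            using t(2) unfolding rescales_def cubic_inject[symmetric] by simp
          then show ?thesis using rescaling_factor_roots[OF rel c, of t] by simp
        next
          assume "swaps \<alpha> \<beta> \<gamma> \<delta> g"
          then have "\<alpha> * c2 = t * c1 \<and> \<beta> * c1 = t * c2 \<and> \<gamma> * c4 = t * c3 \<and> \<delta> * c3 = t * c4"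
            using t(2) unfolding swaps_def cubic_inject[symmetric] by simp
          then show ?thesis using swapping_factor_roots[OF rel t(1) c] by blast
        qed
        then show "\<alpha> \<in> X" "\<beta> \<in> X" unfolding X_def by auto
      qed
      have nz: "\<alpha> \<noteq> 0" "\<beta> \<noteq> 0" using l \<alpha>(1) \<beta>(1) by auto
      then have \<kappa>: "\<beta> / \<alpha>\<^sup>2 \<noteq> 0" "\<alpha> / \<beta>\<^sup>2 \<noteq> 0" by auto
      note odd = square_mult_chain[OF \<alpha>(1) \<beta>(1) l l] square_mult_chain[OF \<alpha>(2) \<beta>(2) l l] square_mult_chain[OF \<alpha>(3) \<beta>(3) l l]
      note even = square_mult_chain[OF \<beta>(1) \<alpha>(2) l l] square_mult_chain[OF \<beta>(2) \<alpha>(3) l l] square_mult_chain[OF \<beta>(3) \<alpha>(1) l l]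
      have "l 1 ^ 63 = 1 / (\<beta> / \<alpha>\<^sup>2) ^ 21" "l 3 ^ 63 = 1 / (\<beta> / \<alpha>\<^sup>2) ^ 21" "l 5 ^ 63 = 1 / (\<beta> / \<alpha>\<^sup>2) ^ 21"
        by (rule cycle_of_quartics[OF l \<kappa>(1) odd(1) odd(2) odd(3)] cycle_of_quartics[OF l \<kappa>(1) odd(2) odd(3) odd(1)]
          cycle_of_quartics[OF l \<kappa>(1) odd(3) odd(1) odd(2)])+
      moreover have "l 2 ^ 63 = 1 / (\<alpha> / \<beta>\<^sup>2) ^ 21" "l 4 ^ 63 = 1 / (\<alpha> / \<beta>\<^sup>2) ^ 21" "l 6 ^ 63 = 1 / (\<alpha> / \<beta>\<^sup>2) ^ 21"
        by (rule cycle_of_quartics[OF l \<kappa>(2) even(1) even(2) even(3)] cycle_of_quartics[OF l \<kappa>(2) even(2) even(3) even(1)]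
          cycle_of_quartics[OF l \<kappa>(2) even(3) even(1) even(2)])+
      ultimately have "\<forall>k. l k \<in> L" using X unfolding forall_6 L_def by blast
      then have "matrix_inv g \<in> {M. \<forall>r k. M $ r $ k \<in> insert 0 L}" by (simp add: h)
      moreover have "g = matrix_inv (matrix_inv g)"
        using det_1_inv[OF N_det[OF g]] by (intro matrix_inv_unique[symmetric]) simp
      ultimately show ?thesis by (rule rev_image_eqI)
    qed
  qed
  then show ?thesis
    using finite_matrices[of "insert 0 L"] \<open>finite L\<close> by (meson finite.insertI finite_imageI finite_subset subsetI)
qed

lemma stable_coords_imp_stable:
  assumes "stable_coords c1 c2 c3 c4" shows "N_stable (cubic_pt c1 c2 c3 c4)"
  using stable_coords_imp_semistable[OF assms] finite_stabilizer[OF assms] orbit_closed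
  unfolding stable_def semistable_def by metis

lemma stable_iff: "N_stable (cubic_pt c1 c2 c3 c4) \<longleftrightarrow> stable_coords c1 c2 c3 c4"
  using stable_coords_imp_stable semistable_imp stable_imp_semistable by blast

lemma semistable_iff: "N_semistable (cubic_pt c1 c2 c3 c4) \<longleftrightarrow> stable_coords c1 c2 c3 c4"
  using stable_coords_imp_semistable semistable_imp by blast

theorem proposition3p7:
  shows "(\<forall>c1 c2 c3 c4 :: complex.
           N_stable (cubic_pt c1 c2 c3 c4) \<longleftrightarrow>
             (c1 \<noteq> 0 \<and> c2 \<noteq> 0) \<or> (c1 \<noteq> 0 \<and> c4 \<noteq> 0) \<or>
             (c2 \<noteq> 0 \<and> c3 \<noteq> 0) \<or> (c3 \<noteq> 0 \<and> c4 \<noteq> 0)) \<and>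
         (\<forall>c1 c2 c3 c4 :: complex.
           N_semistable (cubic_pt c1 c2 c3 c4) \<longrightarrow> N_stable (cubic_pt c1 c2 c3 c4)) \<and>
         unstable_locus scale_fun V_F21 N act =
           proj scale_fun {cubic c1 c2 c3 c4 | c1 c2 c3 c4. c1 = 0 \<and> c3 = 0} \<union>
           proj scale_fun {cubic c1 c2 c3 c4 | c1 c2 c3 c4. c2 = 0 \<and> c4 = 0}"
proof (intro conjI allI)
  show "N_stable (cubic_pt c1 c2 c3 c4) \<longleftrightarrow>
      (c1 \<noteq> 0 \<and> c2 \<noteq> 0) \<or> (c1 \<noteq> 0 \<and> c4 \<noteq> 0) \<or> (c2 \<noteq> 0 \<and> c3 \<noteq> 0) \<or> (c3 \<noteq> 0 \<and> c4 \<noteq> 0)"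
    for c1 c2 c3 c4
    unfolding stable_iff stable_coords_def by blast
  show "N_semistable (cubic_pt c1 c2 c3 c4) \<longrightarrow> N_stable (cubic_pt c1 c2 c3 c4)" for c1 c2 c3 c4
    unfolding stable_iff semistable_iff by blast
  show "unstable_locus scale_fun V_F21 N act =
      proj scale_fun {cubic c1 c2 c3 c4 | c1 c2 c3 c4. c1 = 0 \<and> c3 = 0} \<union>
      proj scale_fun {cubic c1 c2 c3 c4 | c1 c2 c3 c4. c2 = 0 \<and> c4 = 0}" (is "_ = ?R")
  proof (intro equalityI subsetI)
    fix p assume "p \<in> unstable_locus scale_fun V_F21 N act"
    then have p: "p \<in> proj scale_fun V_F21" "\<not> N_semistable p" by (auto simp: unstable_locus_def)
    from p(1) obtain c1 c2 c3 c4 where c: "cubic c1 c2 c3 c4 \<noteq> 0" "p = cubic_pt c1 c2 c3 c4"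
      unfolding proj_def V_F21_eq by blast
    then have "c1 = 0 \<and> c3 = 0 \<or> c2 = 0 \<and> c4 = 0"
      using p(2) unfolding c(2) semistable_iff stable_coords_def by blast
    then show "p \<in> ?R" unfolding c(2) proj_def using c(1) by blast
  next
    fix p assume "p \<in> ?R"
    then obtain c1 c2 c3 c4 where c: "c1 = 0 \<and> c3 = 0 \<or> c2 = 0 \<and> c4 = 0"
        "cubic c1 c2 c3 c4 \<noteq> 0" "p = cubic_pt c1 c2 c3 c4"
      unfolding proj_def by blast
    then have "p \<in> proj scale_fun V_F21" unfolding proj_def by simp
    then show "p \<in> unstable_locus scale_fun V_F21 N act"
      using c(1) unfolding unstable_locus_def c(3) mem_Collect_eq semistable_iff stable_coords_def by blast
  qed
qed

end
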